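(* Let $k$ and $l$ be two positive integers. Then $$\mathrm{WS}_3(k,l)=\begin{cases} 3k & \text{if } k\geq 1 \text{ and } l=1,\\ l & \text{if } k=1 \text{ and } l\geq 2,\\ 2l+2 & \text{if } k=2,\ l\geq 2 \text{ and } l\equiv 0,1\text{ or }5 \pmod 9,\\ 2l+1 & \text{if } k=2 \text{ and } l=3,\\ 2l+1 & \text{if } k=2,\ l\geq 5 \text{ and } l\equiv 2,3,4,6,7\text{ or }8 \pmod 9,\\ 2l & \text{if } k=2 \text{ and } l\in\{2,4\},\\ 3(k-2)l+2 & \text{if } k\geq 3 \text{ and } l\equiv 0\text{ or }2 \pmod 3,\\ k(l+1) & \text{if } (k=3 \text{ or } k\geq 5),\ l\geq 2 \text{ and } l\equiv 1 \pmod 3,\\ k(l+1) & \text{if } k=4,\ l\geq 2 \text{ and } l\equiv 1\text{ or }7 \pmod 9,\\ 4l+3 & \text{if } k=4 \text{ and } l\equiv 4 \pmod 9. \end{cases}$$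
   Context: Let $k,l,m$ be positive integers. A set of integers is called weakly $l$-sum-free modulo $m$ if it contains no pairwise distinct elements $x_1,\ldots,x_l,y$ (that is, $l+1$ pairwise distinct integers) satisfying $x_1+\cdots+x_l\equiv y \pmod m$. A $k$-partition of a set $S$ is a family $S_1,\ldots,S_k$ of subsets of $S$ (possibly empty) such that every element of $S$ is contained in exactly one of them. The generalized weak Schur number modulo $m$, denoted $\mathrm{WS}_m(k,l)$, is the largest integer $n$ for which the set $\{1,2,\ldots,n\}$ admits a $k$-partition into sets that are weakly $l$-sum-free modulo $m$. *)

theory Defs
  imports "HOL-Number_Theory.Number_Theory"
begin

definition weakly_sum_free_mod :: "nat \<Rightarrow> nat \<Rightarrow> int set \<Rightarrow> bool" where
  "weakly_sum_free_mod l m A \<longleftrightarrow>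
     \<not> (\<exists>x :: nat \<Rightarrow> int. \<exists>y.
          (\<forall>i\<in>{1..l}. x i \<in> A) \<and> y \<in> A \<and>
          inj_on x {1..l} \<and> y \<notin> x ` {1..l} \<and>
          [(\<Sum>i=1..l. x i) = y] (mod int m))"

definition k_partition :: "nat \<Rightarrow> 'a set \<Rightarrow> (nat \<Rightarrow> 'a set) \<Rightarrow> bool" where
  "k_partition k S P \<longleftrightarrow>
     (\<forall>i\<in>{1..k}. P i \<subseteq> S) \<and> (\<forall>x\<in>S. \<exists>!i. i \<in> {1..k} \<and> x \<in> P i)"

definition weak_Schur_admissible :: "nat \<Rightarrow> nat \<Rightarrow> nat \<Rightarrow> nat \<Rightarrow> bool" where
  "weak_Schur_admissible m k l n \<longleftrightarrow>
     (\<exists>P. k_partition k {1..int n} P \<and> (\<forall>i\<in>{1..k}. weakly_sum_free_mod l m (P i)))"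

text \<open>For \<open>m > 0\<close> the maximum below is taken over a finite nonempty set, hence is attained;
  see \<open>WS_admissible\<close> and \<open>WS_upper\<close>.\<close>

definition WS :: "nat \<Rightarrow> nat \<Rightarrow> nat \<Rightarrow> nat" where
  "WS m k l = Max {n. weak_Schur_admissible m k l n}"

lemma weak_Schur_admissible_0: "weak_Schur_admissible m k l 0"
  unfolding weak_Schur_admissible_def
  by (rule exI[of _ "\<lambda>_. {}"]) (auto simp: k_partition_def weakly_sum_free_mod_def)

text \<open>Among \<open>k * l + 1\<close> multiples of \<open>m\<close>, some \<open>l + 1\<close> lie in the same part.\<close>

lemma weak_Schur_admissible_bound:
  assumes "m > 0" and "weak_Schur_admissible m k l n"
  shows "n < m * (k * l + 1)"
proof (rule ccontr)
  assume "\<not> ?thesis"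
  hence n: "m * (k * l + 1) \<le> n" by simp
  from assms(2) obtain P where P: "k_partition k {1..int n} P"
    and free: "\<And>i. i \<in> {1..k} \<Longrightarrow> weakly_sum_free_mod l m (P i)"
    unfolding weak_Schur_admissible_def by blast
  define T where "T = (\<lambda>j. int (m * j)) ` {1..k * l + 1}"
  have card_T: "card T = k * l + 1"
    unfolding T_def using assms(1) by (subst card_image) (auto simp: inj_on_def)
  have fin_T: "finite T" by (simp add: T_def)
  have T_sub: "T \<subseteq> {1..int n}"
  proof
    fix t assume "t \<in> T"
    then obtain j where j: "j \<in> {1..k * l + 1}" "t = int (m * j)"
      by (auto simp: T_def)
    have "m * j \<le> m * (k * l + 1)" using j by (intro mult_le_mono2) auto
    with n have "m * j \<le> n" by linarith
    moreover have "m * j \<ge> 1" using j assms(1) by (simp add: Suc_le_eq)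
    ultimately show "t \<in> {1..int n}" unfolding j(2) atLeastAtMost_iff by linarith
  qed
  have cover: "T \<subseteq> (\<Union>i\<in>{1..k}. P i \<inter> T)"
    using P T_sub unfolding k_partition_def by blast
  have "\<exists>i\<in>{1..k}. card (P i \<inter> T) > l"
  proof (rule ccontr)
    assume "\<not> ?thesis"
    hence small: "\<And>i. i \<in> {1..k} \<Longrightarrow> card (P i \<inter> T) \<le> l" by (auto simp: not_less)
    have "card T \<le> card (\<Union>i\<in>{1..k}. P i \<inter> T)"
      using cover fin_T by (intro card_mono) auto
    also have "\<dots> \<le> (\<Sum>i\<in>{1..k}. card (P i \<inter> T))" by (rule card_UN_le) simp
    also have "\<dots> \<le> (\<Sum>i\<in>{1..k}. l)" by (rule sum_mono) (rule small)
    also have "\<dots> = k * l" by simp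
    finally show False using card_T by simp
  qed
  then obtain i where i: "i \<in> {1..k}" "card (P i \<inter> T) > l" by blast
  then obtain U where U: "U \<subseteq> P i \<inter> T" "card U = Suc l"
    by (meson Suc_leI obtain_subset_with_card_n)
  then obtain y V where V: "U = insert y V" "y \<notin> V" "card V = l"
    by (auto simp: card_Suc_eq)
  have "finite V" using U fin_T V(1) by (meson finite_Int finite_subset finite_insert)
  then obtain x where x: "bij_betw x {1..l} V"
    using V(3) finite_same_card_bij[of "{1..l}" V] by auto
  have xV: "x ` {1..l} = V" using x by (simp add: bij_betw_def)
  have dvd: "int m dvd t" if "t \<in> T" for t using that by (auto simp: T_def)
  have "int m dvd (\<Sum>i=1..l. x i)"
  proof (rule dvd_sum)
    fix j assume "j \<in> {1..l}"
    hence "x j \<in> V" using xV by blast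
    thus "int m dvd x j" using V(1) U(1) by (intro dvd) auto
  qed
  moreover have "int m dvd y" using V(1) U(1) by (intro dvd) auto
  ultimately have "[(\<Sum>i=1..l. x i) = y] (mod int m)"
    by (meson cong_0_iff cong_sym cong_trans)
  moreover have "\<forall>j\<in>{1..l}. x j \<in> P i" "y \<in> P i" using xV V(1) U(1) by auto
  moreover have "inj_on x {1..l}" "y \<notin> x ` {1..l}"
    using x xV V(2) by (auto simp: bij_betw_def)
  ultimately show False
    using free[OF i(1)] unfolding weakly_sum_free_mod_def by blast
qed

lemma finite_weak_Schur_admissible:
  assumes "m > 0"
  shows "finite {n. weak_Schur_admissible m k l n}"
  by (rule finite_subset[of _ "{..<m * (k * l + 1)}"])
     (use weak_Schur_admissible_bound[OF assms] in auto)

lemma WS_admissible: "m > 0 \<Longrightarrow> weak_Schur_admissible m k l (WS m k l)"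
  unfolding WS_def
  using Max_in[OF finite_weak_Schur_admissible[of m k l]] weak_Schur_admissible_0 by blast

lemma WS_upper: "m > 0 \<Longrightarrow> weak_Schur_admissible m k l n \<Longrightarrow> n \<le> WS m k l"
  unfolding WS_def by (rule Max_ge) (auto intro: finite_weak_Schur_admissible)

end

theory Submission
  imports Defs "HOL-Library.Product_Plus" "HOL-Library.Disjoint_Sets"
begin

text \<open>
  Modulo 3 only the residues of the elements of a set matter, and the whole problem can be moved
  from sets to triples of numbers. Call \<open>(a, b, c)\<close> the profile of a finite set with \<open>a\<close>, \<open>b\<close>, \<open>c\<close>
  elements of residue 0, 1, 2. If \<open>U\<close> consists of \<open>x\<^sub>1, \<dots>, x\<^sub>l, y\<close> and
  \<open>x\<^sub>1 + \<dots> + x\<^sub>l \<equiv> y\<close>, then \<open>\<Sum>U \<equiv> 2 y \<equiv> - y\<close>; so a set of \<open>l + 1\<close> integers supports a solution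
  exactly if it contains an element of the residue \<open>- \<Sum>U\<close>. This is a condition on the profile of
  \<open>U\<close> (\<open>solution_iff_solvable_profile\<close>), a set is weakly sum-free exactly if no subprofile of size
  \<open>l + 1\<close> satisfies it (\<open>weakly_sum_free_mod_3_iff\<close>), and \<open>{1..n}\<close> can be partitioned as required
  exactly if its profile, which is nearly balanced, is a sum of \<open>k\<close> sum-free profiles
  (\<open>weak_Schur_admissible_3_iff\<close>).

  For \<open>l \<ge> 2\<close> the sum-free profiles are few. Those of size at most \<open>l\<close> are all sum-free.
  In size \<open>l + 1\<close> some residue must be missing, and the counts are then prescribed modulo 3
  (\<open>sum_free_profile_Suc_mod\<close>). A larger sum-free profile has a single residue, which is not 0, and
  exists only if \<open>l\<close> is not congruent to 1 modulo 3 (\<open>sum_free_profile_large\<close>): exchanging one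
  element of \<open>U\<close> for one of another residue shifts \<open>\<Sum>U\<close> and makes one of the two sets solvable.

  The values follow from counting.
  If \<open>l \<equiv> 1\<close>, every part has at most \<open>l + 1\<close> elements, so \<open>k (l + 1)\<close> is an upper bound. It is reached
  if the counts of \<open>{1..n}\<close> split into pairs of numbers congruent to 1; three additional parts
  always allow such a splitting to be continued, which leaves finitely many \<open>k\<close>. The exceptions occur
  where the counts modulo 3 do not permit any distribution of the residues over the parts.
  If \<open>l\<close> is not congruent to 1 and \<open>k \<ge> 3\<close>, one part takes all elements of residue 1, one takes those of residue 2,
  and the multiples of 3, of which a sum-free part has at most \<open>l\<close>, fill the others. No partition
  does better, because \<open>(k - 2) l + 1\<close> multiples of 3 occupy at least \<open>k - 1\<close> parts, which are thereby
  confined to \<open>l + 1\<close> elements; this is too few for \<open>k \<ge> 4\<close>, and for \<open>k = 3\<close> it forces all parts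
  to have exactly \<open>l + 1\<close> elements, which the prescribed residues exclude.
  If \<open>k = 2\<close>, an interval with at most \<open>2 l + 3\<close> elements has too few of each residue for a part to
  exceed \<open>l + 1\<close> elements, and the prescribed residues decide, depending on \<open>l\<close> modulo 9, whether both
  parts can attain this size. One part can always attain it, unless \<open>l\<close> is 2 or 4 and the
  interval is too short to contain the prescribed counts.
\<close>

section \<open>Residue profiles\<close>

text \<open>
  Collecting \<open>x\<^sub>1, \<dots>, x\<^sub>l, y\<close> into one set \<open>U\<close> turns the equation into \<open>\<Sum>U \<equiv> 2 y\<close>, which no
  longer depends on how \<open>U - {y}\<close> is enumerated.
\<close>

lemma weakly_sum_free_mod_iff_subset:
  "weakly_sum_free_mod l m A \<longleftrightarrow>
     \<not> (\<exists>U\<subseteq>A. finite U \<and> card U = Suc l \<and> (\<exists>y\<in>U. [\<Sum>U = 2 * y] (mod int m)))"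
proof -
  have "(\<exists>x :: nat \<Rightarrow> int. \<exists>y. (\<forall>i\<in>{1..l}. x i \<in> A) \<and> y \<in> A \<and>
          inj_on x {1..l} \<and> y \<notin> x ` {1..l} \<and> [(\<Sum>i=1..l. x i) = y] (mod int m)) \<longleftrightarrow>
        (\<exists>U\<subseteq>A. finite U \<and> card U = Suc l \<and> (\<exists>y\<in>U. [\<Sum>U = 2 * y] (mod int m)))"
    (is "?L \<longleftrightarrow> ?R")
  proof
    assume ?L
    then obtain x :: "nat \<Rightarrow> int" and y where x: "\<forall>i\<in>{1..l}. x i \<in> A" "y \<in> A" "inj_on x {1..l}"
      "y \<notin> x ` {1..l}" and eq: "[(\<Sum>i=1..l. x i) = y] (mod int m)" by blast
    let ?U = "insert y (x ` {1..l})"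
    have "\<Sum>?U = y + (\<Sum>i=1..l. x i)"
      using x by (simp add: sum.reindex)
    also have "[\<dots> = y + y] (mod int m)"
      using eq by (rule cong_add[OF cong_refl])
    finally have "[\<Sum>?U = 2 * y] (mod int m)" by simp
    moreover have "card ?U = Suc l" using x by (simp add: card_image)
    moreover have "?U \<subseteq> A" using x by auto
    ultimately show ?R by (intro exI[of _ ?U]) auto
  next
    assume ?R
    then obtain U y where U: "U \<subseteq> A" "finite U" "card U = Suc l" "y \<in> U"
      and eq: "[\<Sum>U = 2 * y] (mod int m)" by blast
    have "card {1..l} = card (U - {y})" using U by simp
    then obtain x where x: "bij_betw x {1..l} (U - {y})"
      using finite_same_card_bij[of "{1..l}" "U - {y}"] U by auto
    have "(\<Sum>i=1..l. x i) = \<Sum>(U - {y})" by (rule sum.reindex_bij_betw[OF x])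
    also have "\<dots> = \<Sum>U - y" using U by (simp add: sum_diff1)
    also have "[\<dots> = 2 * y - y] (mod int m)" using eq by (rule cong_diff[OF _ cong_refl])
    finally have "[(\<Sum>i=1..l. x i) = y] (mod int m)" by simp
    moreover have "\<forall>i\<in>{1..l}. x i \<in> U - {y}" using x by (auto simp: bij_betw_def)
    moreover have "inj_on x {1..l}" "y \<notin> x ` {1..l}" using x by (auto simp: bij_betw_def)
    ultimately show ?L using U by blast
  qed
  thus ?thesis by (simp add: weakly_sum_free_mod_def)
qed

definition residue_profile :: "int set \<Rightarrow> nat \<times> nat \<times> nat" where
  "residue_profile A =
     (card {z \<in> A. z mod 3 = 0}, card {z \<in> A. z mod 3 = 1}, card {z \<in> A. z mod 3 = 2})"

text \<open>
  A set with \<open>u\<close>, \<open>v\<close>, \<open>w\<close> elements of residue 0, 1, 2 has the sum \<open>v + 2 w\<close> modulo 3. The three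
  disjuncts say, for each value of this sum, that the set contains an element of the opposite
  residue, which can then serve as \<open>y\<close> with all other elements as summands.
\<close>

definition solvable_profile :: "nat \<Rightarrow> nat \<Rightarrow> nat \<Rightarrow> bool" where
  "solvable_profile u v w \<longleftrightarrow>
     (v + 2 * w) mod 3 = 0 \<and> u > 0 \<or> (v + 2 * w) mod 3 = 1 \<and> w > 0 \<or>
     (v + 2 * w) mod 3 = 2 \<and> v > 0"

text \<open>
  The subprofiles of size \<open>l + 1\<close> are the profiles of the sets \<open>{x\<^sub>1, \<dots>, x\<^sub>l, y}\<close> that could
  carry a solution.
\<close>

definition sum_free_profile :: "nat \<Rightarrow> nat \<times> nat \<times> nat \<Rightarrow> bool" where
  "sum_free_profile l = (\<lambda>(a, b, c).
     \<forall>u v w. u \<le> a \<and> v \<le> b \<and> w \<le> c \<and> u + v + w = Suc l \<longrightarrow> \<not> solvable_profile u v w)"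

lemma residue_split:
  fixes A :: "int set"
  shows "A = {z \<in> A. z mod 3 = 0} \<union> {z \<in> A. z mod 3 = 1} \<union> {z \<in> A. z mod 3 = 2}"
proof -
  have "z mod 3 = 0 \<or> z mod 3 = 1 \<or> z mod 3 = 2" for z :: int by presburger
  thus ?thesis by blast
qed

lemma sum_by_residue:
  fixes f :: "int \<Rightarrow> 'b :: comm_monoid_add"
  assumes "finite A"
  shows "sum f A = sum f {z \<in> A. z mod 3 = 0} + sum f {z \<in> A. z mod 3 = 1} +
    sum f {z \<in> A. z mod 3 = 2}"
proof -
  have "sum f A = sum f ({z \<in> A. z mod 3 = 0} \<union> {z \<in> A. z mod 3 = 1} \<union> {z \<in> A. z mod 3 = 2})"
    using residue_split[of A] by simp
  also have "\<dots> = sum f ({z \<in> A. z mod 3 = 0} \<union> {z \<in> A. z mod 3 = 1}) + sum f {z \<in> A. z mod 3 = 2}"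
    using assms by (intro sum.union_disjoint) auto
  also have "sum f ({z \<in> A. z mod 3 = 0} \<union> {z \<in> A. z mod 3 = 1}) =
      sum f {z \<in> A. z mod 3 = 0} + sum f {z \<in> A. z mod 3 = 1}"
    using assms by (intro sum.union_disjoint) auto
  finally show ?thesis .
qed

lemma solution_iff_solvable_profile:
  assumes "finite U" and "residue_profile U = (u, v, w)"
  shows "(\<exists>y\<in>U. [\<Sum>U = 2 * y] (mod int 3)) \<longleftrightarrow> solvable_profile u v w"
proof -
  have u: "u = card {z \<in> U. z mod 3 = 0}" and v: "v = card {z \<in> U. z mod 3 = 1}"
    and w: "w = card {z \<in> U. z mod 3 = 2}"
    using assms(2) by (auto simp: residue_profile_def)
  have "[\<Sum>U = (\<Sum>z\<in>U. z mod 3)] (mod 3)"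
    by (intro cong_sum) (simp add: cong_def)
  also have "(\<Sum>z\<in>U. z mod 3) = int (v + 2 * w)"
    unfolding sum_by_residue[OF assms(1)] by (simp add: v w)
  finally have "(\<Sum>U) mod 3 = int ((v + 2 * w) mod 3)"
    unfolding cong_def by (simp add: zmod_int)
  hence sol: "[\<Sum>U = 2 * y] (mod int 3) \<longleftrightarrow> int ((v + 2 * w) mod 3) = (2 * y) mod 3" for y
    by (simp add: cong_def)
  have pos: "u > 0 \<longleftrightarrow> (\<exists>z\<in>U. z mod 3 = 0)" "v > 0 \<longleftrightarrow> (\<exists>z\<in>U. z mod 3 = 1)"
    "w > 0 \<longleftrightarrow> (\<exists>z\<in>U. z mod 3 = 2)"
    unfolding u v w card_gt_0_iff using assms(1) by force+
  have res: "(2 * y) mod 3 = (if y mod 3 = 0 then 0 else if y mod 3 = 1 then 2 else 1)" for y :: int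
    by presburger
  have three: "y mod 3 = 0 \<or> y mod 3 = 1 \<or> y mod 3 = 2" for y :: int by presburger
  show ?thesis
  proof
    assume "\<exists>y\<in>U. [\<Sum>U = 2 * y] (mod int 3)"
    then obtain y where "y \<in> U" "int ((v + 2 * w) mod 3) = (2 * y) mod 3"
      using sol by blast
    with three[of y] show "solvable_profile u v w"
      unfolding solvable_profile_def pos res by (elim disjE) force+
  next
    assume "solvable_profile u v w"
    then obtain y where "y \<in> U" "int ((v + 2 * w) mod 3) = (if y mod 3 = 0 then 0 else if y mod 3 = 1 then 2 else 1)"
      unfolding solvable_profile_def pos by (elim disjE conjE bexE) force+
    thus "\<exists>y\<in>U. [\<Sum>U = 2 * y] (mod int 3)"
      unfolding sol res by blast
  qed
qed

lemma sum_residue_profile: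
  assumes "finite A" and "residue_profile A = (a, b, c)"
  shows "card A = a + b + c"
  using sum_by_residue[OF assms(1), of "\<lambda>_. 1 :: nat"] assms(2) by (simp add: residue_profile_def)

lemma residue_profile_mono:
  assumes "finite A" and "U \<subseteq> A" and "residue_profile A = (a, b, c)"
    and "residue_profile U = (u, v, w)"
  shows "u \<le> a \<and> v \<le> b \<and> w \<le> c"
  using assms by (auto simp: residue_profile_def intro!: card_mono)

lemma subset_with_residue_profile:
  assumes "finite A" and "residue_profile A = (a, b, c)" and "u \<le> a" "v \<le> b" "w \<le> c"
  shows "\<exists>U\<subseteq>A. residue_profile U = (u, v, w)"
proof -
  have "u \<le> card {z \<in> A. z mod 3 = 0}" "v \<le> card {z \<in> A. z mod 3 = 1}"
    "w \<le> card {z \<in> A. z mod 3 = 2}"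
    using assms by (auto simp: residue_profile_def)
  then obtain X Y Z where X: "X \<subseteq> {z \<in> A. z mod 3 = 0}" "card X = u"
    and Y: "Y \<subseteq> {z \<in> A. z mod 3 = 1}" "card Y = v"
    and Z: "Z \<subseteq> {z \<in> A. z mod 3 = 2}" "card Z = w"
    by (meson obtain_subset_with_card_n)
  have "{z \<in> X \<union> Y \<union> Z. z mod 3 = 0} = X" "{z \<in> X \<union> Y \<union> Z. z mod 3 = 1} = Y"
    "{z \<in> X \<union> Y \<union> Z. z mod 3 = 2} = Z"
    using X Y Z by auto
  with X Y Z show ?thesis
    by (intro exI[of _ "X \<union> Y \<union> Z"]) (auto simp: residue_profile_def)
qed

lemma weakly_sum_free_mod_3_iff:
  assumes "finite A"
  shows "weakly_sum_free_mod l 3 A \<longleftrightarrow> sum_free_profile l (residue_profile A)"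
proof -
  obtain a b c where abc: "residue_profile A = (a, b, c)" by (metis prod_cases3)
  have "(\<exists>U\<subseteq>A. finite U \<and> card U = Suc l \<and> (\<exists>y\<in>U. [\<Sum>U = 2 * y] (mod int 3))) \<longleftrightarrow>
    (\<exists>u v w. (u \<le> a \<and> v \<le> b \<and> w \<le> c \<and> u + v + w = Suc l) \<and> solvable_profile u v w)"
    (is "?L \<longleftrightarrow> ?R")
  proof
    assume ?L
    then obtain U where U: "U \<subseteq> A" "finite U" "card U = Suc l" "\<exists>y\<in>U. [\<Sum>U = 2 * y] (mod int 3)"
      by blast
    obtain u v w where uvw: "residue_profile U = (u, v, w)" by (metis prod_cases3)
    show ?R
      using residue_profile_mono[OF assms U(1) abc uvw] sum_residue_profile[OF U(2) uvw]
        solution_iff_solvable_profile[OF U(2) uvw] U by auto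
  next
    assume ?R
    then obtain u v w where uvw: "u \<le> a" "v \<le> b" "w \<le> c" "u + v + w = Suc l"
      "solvable_profile u v w" by blast
    obtain U where U: "U \<subseteq> A" "residue_profile U = (u, v, w)"
      using subset_with_residue_profile[OF assms abc uvw(1-3)] by blast
    have "finite U" using U(1) assms by (rule finite_subset)
    thus ?L
      using U uvw solution_iff_solvable_profile[OF _ U(2)] sum_residue_profile[OF _ U(2)] by metis
  qed
  thus ?thesis
    unfolding weakly_sum_free_mod_iff_subset abc sum_free_profile_def by auto
qed

section \<open>Partitions as sums of profiles\<close>

lemma residue_profile_interval:
  "residue_profile {1..int n} = (n div 3, (n + 2) div 3, (n + 1) div 3)"
proof (induction n)
  case 0
  show ?case by (simp add: residue_profile_def)
next
  case (Suc n)
  have ins: "{1..int (Suc n)} = insert (int n + 1) {1..int n}" by auto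
  have *: "card {z \<in> {1..int (Suc n)}. z mod 3 = r} =
    card {z \<in> {1..int n}. z mod 3 = r} + (if (int n + 1) mod 3 = r then 1 else 0)" for r
  proof -
    have "{z \<in> {1..int (Suc n)}. z mod 3 = r} =
      (if (int n + 1) mod 3 = r then insert (int n + 1) {z \<in> {1..int n}. z mod 3 = r}
       else {z \<in> {1..int n}. z mod 3 = r})"
      unfolding ins by auto
    moreover have "finite {z \<in> {1..int n}. z mod 3 = r}" "int n + 1 \<notin> {z \<in> {1..int n}. z mod 3 = r}"
      by (auto intro: finite_subset[of _ "{1..int n}"])
    ultimately show ?thesis
      by (cases "(int n + 1) mod 3 = r") (simp_all only: card_insert_disjoint simp_thms if_True if_False Suc_eq_plus1 add_0_right)
  qed
  have "n div 3 + (if (int n + 1) mod 3 = 0 then 1 else 0) = Suc n div 3"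
    "(n + 2) div 3 + (if (int n + 1) mod 3 = 1 then 1 else 0) = (Suc n + 2) div 3"
    "(n + 1) div 3 + (if (int n + 1) mod 3 = 2 then 1 else 0) = (Suc n + 1) div 3"
  proof -
    define q where "q = n div 3"
    consider "n = 3 * q" | "n = 3 * q + 1" | "n = 3 * q + 2" unfolding q_def by linarith
    hence "n div 3 + (if (int n + 1) mod 3 = 0 then 1 else 0) = Suc n div 3 \<and>
      (n + 2) div 3 + (if (int n + 1) mod 3 = 1 then 1 else 0) = (Suc n + 2) div 3 \<and>
      (n + 1) div 3 + (if (int n + 1) mod 3 = 2 then 1 else 0) = (Suc n + 1) div 3"
      by cases (simp_all, presburger+)
    thus "n div 3 + (if (int n + 1) mod 3 = 0 then 1 else 0) = Suc n div 3"
      "(n + 2) div 3 + (if (int n + 1) mod 3 = 1 then 1 else 0) = (Suc n + 2) div 3"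
      "(n + 1) div 3 + (if (int n + 1) mod 3 = 2 then 1 else 0) = (Suc n + 1) div 3" by auto
  qed
  thus ?case using Suc.IH unfolding residue_profile_def * by simp
qed

lemma residue_profile_Un:
  assumes "finite A" "finite B" "A \<inter> B = {}"
  shows "residue_profile (A \<union> B) = residue_profile A + residue_profile B"
proof -
  have "card {z \<in> A \<union> B. z mod 3 = r} = card {z \<in> A. z mod 3 = r} + card {z \<in> B. z mod 3 = r}" for r
  proof -
    have "{z \<in> A \<union> B. z mod 3 = r} = {z \<in> A. z mod 3 = r} \<union> {z \<in> B. z mod 3 = r}" by auto
    thus ?thesis using assms by (simp add: card_Un_disjoint disjoint_iff)
  qed
  thus ?thesis by (simp add: residue_profile_def)
qed

lemma residue_profile_empty [simp]: "residue_profile {} = 0"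
  by (simp add: residue_profile_def zero_prod_def)

lemma residue_profile_UN:
  assumes "finite I" and "\<And>i. i \<in> I \<Longrightarrow> finite (P i)" and "disjoint_family_on P I"
  shows "residue_profile (\<Union>i\<in>I. P i) = (\<Sum>i\<in>I. residue_profile (P i))"
  using assms
proof (induction I rule: finite_induct)
  case (insert i I)
  have "P i \<inter> (\<Union>j\<in>I. P j) = {}"
    using insert.prems(2) insert.hyps(2) by (fastforce simp: disjoint_family_on_def)
  moreover have "residue_profile (\<Union>j\<in>I. P j) = (\<Sum>j\<in>I. residue_profile (P j))"
    using insert by (auto simp: disjoint_family_on_def)
  ultimately show ?case
    using insert by (simp add: residue_profile_Un)
qed simp

text \<open>
  Converse of \<open>residue_profile_UN\<close>: parts with prescribed profiles can be cut off one after the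
  other, because what remains has the sum of the remaining profiles.
\<close>

lemma partition_with_residue_profiles:
  assumes "finite A" and "residue_profile A = sum_list ps"
  shows "\<exists>P. (\<Union>i<length ps. P i) = A \<and> disjoint_family_on P {..<length ps} \<and>
    (\<forall>i<length ps. residue_profile (P i) = ps ! i)"
  using assms
proof (induction ps arbitrary: A)
  case Nil
  then obtain "card A = 0"
    using sum_residue_profile[of A 0 0 0] by (simp add: zero_prod_def)
  thus ?case using Nil by (simp add: disjoint_family_on_def)
next
  case (Cons p ps)
  obtain a b c where p: "p = (a, b, c)" by (metis prod_cases3)
  obtain a' b' c' where ps: "sum_list ps = (a', b', c')" by (metis prod_cases3)
  have A: "residue_profile A = (a + a', b + b', c + c')"
    using Cons.prems(2) by (simp add: p ps)
  obtain U where U: "U \<subseteq> A" "residue_profile U = p"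
    using subset_with_residue_profile[OF Cons.prems(1) A, of a b c] p by auto
  have fin: "finite U" "finite (A - U)" using U Cons.prems(1) finite_subset by auto
  have "residue_profile A = residue_profile U + residue_profile (A - U)"
    using residue_profile_Un[OF fin] U by (simp add: Un_absorb1)
  hence "residue_profile (A - U) = sum_list ps"
    using Cons.prems(2) U by simp
  from Cons.IH[OF fin(2) this] obtain P where P: "(\<Union>i<length ps. P i) = A - U"
    "disjoint_family_on P {..<length ps}" "\<forall>i<length ps. residue_profile (P i) = ps ! i"
    by blast
  let ?Q = "case_nat U P"
  have *: "{..<length (p # ps)} = insert 0 (Suc ` {..<length ps})"
    using lessThan_Suc_eq_insert_0 by simp
  have "(\<Union>i<length (p # ps). ?Q i) = A"
    unfolding * using P(1) U(1) by auto
  moreover have "disjoint_family_on ?Q {..<length (p # ps)}"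
    unfolding * using P(1,2) by (fastforce simp: disjoint_family_on_def)
  moreover have "\<forall>i<length (p # ps). residue_profile (?Q i) = (p # ps) ! i"
    using P(3) U(2) by (auto simp: nth_Cons split: nat.splits)
  ultimately show ?case by blast
qed

lemma weak_Schur_admissible_3_iff:
  "weak_Schur_admissible 3 k l n \<longleftrightarrow>
     (\<exists>ps. length ps = k \<and> (\<forall>p\<in>set ps. sum_free_profile l p) \<and>
        sum_list ps = (n div 3, (n + 2) div 3, (n + 1) div 3))"
proof
  assume "weak_Schur_admissible 3 k l n"
  then obtain P where P: "k_partition k {1..int n} P"
    and free: "\<forall>i\<in>{1..k}. weakly_sum_free_mod l 3 (P i)"
    unfolding weak_Schur_admissible_def by blast
  have fin: "finite (P i)" if "i \<in> {1..k}" for i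
    using P that unfolding k_partition_def by (meson finite_atLeastAtMost_int finite_subset)
  have cover: "(\<Union>i\<in>{1..k}. P i) = {1..int n}"
    using P unfolding k_partition_def by blast
  have "disjoint_family_on P {1..k}"
    using P unfolding k_partition_def disjoint_family_on_def by blast
  hence sum: "(\<Sum>i\<in>{1..k}. residue_profile (P i)) = residue_profile {1..int n}"
    using residue_profile_UN[of "{1..k}" P] fin cover by simp
  let ?ps = "map (\<lambda>i. residue_profile (P i)) [1..<Suc k]"
  have "sum_list ?ps = (\<Sum>i\<in>{1..k}. residue_profile (P i))"
    by (subst sum_set_upt_conv_sum_list_nat[symmetric]) (simp only: set_upt atLeastLessThanSuc_atLeastAtMost)
  moreover have "\<forall>p\<in>set ?ps. sum_free_profile l p"
    using free fin weakly_sum_free_mod_3_iff by fastforce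
  ultimately show "\<exists>ps. length ps = k \<and> (\<forall>p\<in>set ps. sum_free_profile l p) \<and>
        sum_list ps = (n div 3, (n + 2) div 3, (n + 1) div 3)"
    using sum residue_profile_interval by (intro exI[of _ ?ps]) auto
next
  assume "\<exists>ps. length ps = k \<and> (\<forall>p\<in>set ps. sum_free_profile l p) \<and>
        sum_list ps = (n div 3, (n + 2) div 3, (n + 1) div 3)"
  then obtain ps where ps: "length ps = k" "\<forall>p\<in>set ps. sum_free_profile l p"
    "residue_profile {1..int n} = sum_list ps"
    using residue_profile_interval by auto
  obtain P where P: "(\<Union>i<k. P i) = {1..int n}" "disjoint_family_on P {..<k}"
    "\<forall>i<k. residue_profile (P i) = ps ! i"
    using partition_with_residue_profiles[OF _ ps(3)] ps(1) by auto
  let ?Q = "\<lambda>i. P (i - 1)"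
  have sub: "P i \<subseteq> {1..int n}" if "i < k" for i using P(1) that by blast
  have "k_partition k {1..int n} ?Q"
    unfolding k_partition_def
  proof (intro conjI ballI)
    fix i assume "i \<in> {1..k}"
    thus "?Q i \<subseteq> {1..int n}" by (intro sub) auto
  next
    fix x assume "x \<in> {1..int n}"
    then obtain i where i: "i < k" "x \<in> P i" using P(1) by blast
    show "\<exists>!i. i \<in> {1..k} \<and> x \<in> ?Q i"
    proof (rule ex1I[of _ "Suc i"])
      fix j assume j: "j \<in> {1..k} \<and> x \<in> ?Q j"
      hence "j - 1 < k" by auto
      hence "j - 1 = i" using P(2) i j unfolding disjoint_family_on_def by blast
      thus "j = Suc i" using j by auto
    qed (use i in auto)
  qed
  moreover have "\<forall>i\<in>{1..k}. weakly_sum_free_mod l 3 (?Q i)"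
  proof
    fix i assume i: "i \<in> {1..k}"
    hence "i - 1 < k" by auto
    moreover from this have "finite (?Q i)" using sub finite_subset by blast
    ultimately show "weakly_sum_free_mod l 3 (?Q i)"
      using P(3) ps(1,2) by (simp add: weakly_sum_free_mod_3_iff)
  qed
  ultimately show "weak_Schur_admissible 3 k l n"
    unfolding weak_Schur_admissible_def by blast
qed

text \<open>
  Partitions restrict to shorter intervals, so that a value of \<open>WS\<close> is settled by one construction
  and one obstruction, at consecutive integers.
\<close>

lemma weak_Schur_admissible_antimono:
  assumes "weak_Schur_admissible m k l n" and "n' \<le> n"
  shows "weak_Schur_admissible m k l n'"
proof -
  obtain P where P: "k_partition k {1..int n} P"
    "\<forall>i\<in>{1..k}. weakly_sum_free_mod l m (P i)"
    using assms(1) unfolding weak_Schur_admissible_def by blast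
  have "k_partition k {1..int n'} (\<lambda>i. P i \<inter> {1..int n'})"
    using P(1) assms(2) unfolding k_partition_def by auto
  moreover have "\<forall>i\<in>{1..k}. weakly_sum_free_mod l m (P i \<inter> {1..int n'})"
    using P(2) unfolding weakly_sum_free_mod_iff_subset by blast
  ultimately show ?thesis unfolding weak_Schur_admissible_def by blast
qed

lemma WS_eqI:
  assumes "m > 0" and "weak_Schur_admissible m k l n" and "\<not> weak_Schur_admissible m k l (Suc n)"
  shows "WS m k l = n"
  using WS_upper[OF assms(1,2)] WS_admissible[OF assms(1), of k l] assms(3)
    weak_Schur_admissible_antimono[of m k l "WS m k l" "Suc n"] by (meson le_antisym not_less_eq_eq)

lemma sum_list_replicate_profile:
  "sum_list (replicate k (a, b, c)) = (k * a, k * b, k * c :: nat)"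
  by (induction k) (auto simp: zero_prod_def)

lemma sum_list_profile_components:
  "sum_list ps = (sum_list (map fst ps), sum_list (map (fst \<circ> snd) ps),
     sum_list (map (snd \<circ> snd) ps))"
  by (induction ps) (auto simp: zero_prod_def)

lemma sum_list_le_support:
  fixes xs :: "nat list"
  assumes "\<And>x. x \<in> set xs \<Longrightarrow> x \<le> s"
  shows "sum_list xs \<le> s * length (filter (\<lambda>x. x > 0) xs)"
  using assms by (induction xs) fastforce+

text \<open>
  Counts congruent to 1 wherever they are nonzero reveal, by their sum, the number of parts in
  which a residue occurs.
\<close>

lemma sum_list_mod_support:
  fixes xs :: "nat list"
  assumes "\<And>x. x \<in> set xs \<Longrightarrow> x = 0 \<or> x mod m = 1"
  shows "sum_list xs mod m = length (filter (\<lambda>x. x > 0) xs) mod m"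
  using assms
proof (induction xs)
  case (Cons x xs)
  show ?case
  proof (cases "x = 0")
    case False
    hence "x mod m = 1" using Cons.prems by auto
    hence "(x + sum_list xs) mod m = (1 + sum_list xs) mod m" by (metis mod_add_left_eq)
    also have "\<dots> = (1 + length (filter (\<lambda>x. x > 0) xs)) mod m"
      using Cons by (metis list.set_intros(2) mod_add_right_eq)
    finally show ?thesis using False by simp
  qed (use Cons in simp)
qed simp

lemma total_le:
  fixes ps :: "(nat \<times> nat \<times> nat) list"
  assumes "sum_list ps = (A, B, C)" and "\<And>a b c. (a, b, c) \<in> set ps \<Longrightarrow> a + b + c \<le> s"
  shows "A + B + C \<le> s * length ps"
  using assms
proof (induction ps arbitrary: A B C)
  case (Cons p ps)
  obtain a b c where p: "p = (a, b, c)" by (metis prod_cases3)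
  obtain A' B' C' where ps: "sum_list ps = (A', B', C')" by (metis prod_cases3)
  have "A' + B' + C' \<le> s * length ps" using Cons.IH[OF ps] Cons.prems(2) by auto
  moreover have "a + b + c \<le> s" using Cons.prems(2) p by auto
  ultimately show ?case using Cons.prems(1) by (auto simp: p ps)
qed (auto simp: zero_prod_def)

text \<open>
  The parts that contain multiples of 3 obey a stronger size bound \<open>s\<close> than the others, so the two
  kinds are counted separately.
\<close>

lemma total_le_by_zero_support:
  fixes ps :: "(nat \<times> nat \<times> nat) list"
  assumes "sum_list ps = (A, B, C)"
    and "\<And>a b c. (a, b, c) \<in> set ps \<Longrightarrow> a + b + c \<le> (if a > 0 then s else t)"
  shows "A + B + C \<le> s * length (filter (\<lambda>x. x > 0) (map fst ps)) +
    t * (length ps - length (filter (\<lambda>x. x > 0) (map fst ps)))"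
  using assms
proof (induction ps arbitrary: A B C)
  case (Cons p ps)
  obtain a b c where p: "p = (a, b, c)" by (metis prod_cases3)
  obtain A' B' C' where ps: "sum_list ps = (A', B', C')" by (metis prod_cases3)
  have IH: "A' + B' + C' \<le> s * length (filter (\<lambda>x. x > 0) (map fst ps)) +
    t * (length ps - length (filter (\<lambda>x. x > 0) (map fst ps)))"
    using Cons.IH[OF ps] Cons.prems(2) by auto
  have "a + b + c \<le> (if a > 0 then s else t)" using Cons.prems(2) p by auto
  moreover have "length (filter (\<lambda>x. x > 0) (map fst ps)) \<le> length ps"
    using length_filter_le[of "\<lambda>x. x > 0" "map fst ps"] by simp
  ultimately show ?case
    using Cons.prems(1) IH by (auto simp: p ps Suc_diff_le split: if_splits)
qed (auto simp: zero_prod_def)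

lemma profile_le_sum_list:
  fixes ps :: "(nat \<times> nat \<times> nat) list"
  assumes "(a, b, c) \<in> set ps" and "sum_list ps = (A, B, C)"
  shows "a \<le> A \<and> b \<le> B \<and> c \<le> C"
proof -
  have "a \<in> set (map fst ps)" "b \<in> set (map (fst \<circ> snd) ps)" "c \<in> set (map (snd \<circ> snd) ps)"
    using assms(1) by force+
  from this[THEN member_le_sum_list] show ?thesis
    using assms(2) unfolding sum_list_profile_components[of ps] by simp
qed

lemma weak_Schur_admissible_3_obtain:
  assumes "weak_Schur_admissible 3 k l n"
  obtains ps where "length ps = k" "\<And>a b c. (a, b, c) \<in> set ps \<Longrightarrow> sum_free_profile l (a, b, c)"
    "sum_list ps = (n div 3, (n + 2) div 3, (n + 1) div 3)"
  using assms unfolding weak_Schur_admissible_3_iff by auto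

lemma div_3_sum: "n div 3 + (n + 2) div 3 + (n + 1) div 3 = (n :: nat)"
proof -
  define q where "q = n div 3"
  consider "n = 3 * q" | "n = 3 * q + 1" | "n = 3 * q + 2" unfolding q_def by linarith
  thus ?thesis by cases (simp_all, presburger+)
qed

text \<open>
  The condition on the sum describes the profiles of the intervals \<open>{1..n}\<close> without division,
  which makes explicit constructions checkable by linear arithmetic.
\<close>

lemma weak_Schur_admissible_3_intro:
  assumes "length ps = k" and "list_all (sum_free_profile l) ps"
    and "case sum_list ps of (A, B, C) \<Rightarrow> A \<le> C \<and> C \<le> B \<and> B \<le> A + 1 \<and> n = A + B + C"
  shows "weak_Schur_admissible 3 k l n"
proof -
  obtain A B C where ABC: "sum_list ps = (A, B, C)" by (metis prod_cases3)
  with assms(3) consider "B = A" "C = A" "n = 3 * A" | "B = A + 1" "C = A" "n = 3 * A + 1" |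
    "B = A + 1" "C = A + 1" "n = 3 * A + 2" by fastforce
  hence "sum_list ps = (n div 3, (n + 2) div 3, (n + 1) div 3)"
    unfolding ABC by cases (simp; presburger)+
  thus ?thesis
    using assms(1,2) unfolding weak_Schur_admissible_3_iff list_all_iff by blast
qed

section \<open>Classification of the sum-free profiles\<close>

lemma mod_3_cases:
  fixes n :: nat
  obtains "n mod 3 = 0" | "n mod 3 = 1" | "n mod 3 = 2"
  by linarith

text \<open>
  The criterion in terms of the single residues, a form in which case distinctions over
  \<open>v mod 3\<close> and \<open>w mod 3\<close> can be evaluated by rewriting.
\<close>

lemma solvable_profile_iff_mod:
  "solvable_profile u v w \<longleftrightarrow> v mod 3 = w mod 3 \<and> u > 0 \<or> v mod 3 = Suc (w mod 3) mod 3 \<and> w > 0 \<or>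
     w mod 3 = Suc (v mod 3) mod 3 \<and> v > 0"
proof -
  have "(v + 2 * w) mod 3 = (v mod 3 + (2 * (w mod 3)) mod 3) mod 3"
    by (simp only: mod_add_eq mod_mult_right_eq)
  thus ?thesis
    unfolding solvable_profile_def by (cases v rule: mod_3_cases; cases w rule: mod_3_cases) simp_all
qed

lemma sum_free_profileD:
  "sum_free_profile l (a, b, c) \<Longrightarrow> u \<le> a \<Longrightarrow> v \<le> b \<Longrightarrow> w \<le> c \<Longrightarrow> u + v + w = Suc l \<Longrightarrow>
     \<not> solvable_profile u v w"
  by (auto simp: sum_free_profile_def)

lemma sum_free_profile_small: "a + b + c \<le> l \<Longrightarrow> sum_free_profile l (a, b, c)"
  by (auto simp: sum_free_profile_def)

lemma sum_free_profile_exact: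
  assumes "a + b + c = Suc l"
  shows "sum_free_profile l (a, b, c) \<longleftrightarrow> \<not> solvable_profile a b c"
proof
  assume "\<not> solvable_profile a b c"
  moreover have "u = a \<and> v = b \<and> w = c"
    if "u \<le> a" "v \<le> b" "w \<le> c" "u + v + w = Suc l" for u v w
    using that assms by linarith
  ultimately show "sum_free_profile l (a, b, c)"
    unfolding sum_free_profile_def by auto
qed (use assms sum_free_profileD in blast)

lemma sum_free_profile_monochromatic:
  assumes "l mod 3 \<noteq> 1"
  shows "sum_free_profile l (0, b, 0)" and "sum_free_profile l (0, 0, c)"
  using assms unfolding sum_free_profile_def solvable_profile_iff_mod
  by (cases l rule: mod_3_cases; auto simp: mod_Suc)+

lemma solvable_if_all_residues:
  "u > 0 \<Longrightarrow> v > 0 \<Longrightarrow> w > 0 \<Longrightarrow> solvable_profile u v w"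
  unfolding solvable_profile_iff_mod
  by (cases v rule: mod_3_cases; cases w rule: mod_3_cases) simp_all

lemma choose_subprofile:
  fixes a b c :: nat
  assumes "a0 \<le> a" "b0 \<le> b" "c0 \<le> c" "a0 + b0 + c0 \<le> s" "s \<le> a + b + c"
  shows "\<exists>u v w. a0 \<le> u \<and> u \<le> a \<and> b0 \<le> v \<and> v \<le> b \<and> c0 \<le> w \<and> w \<le> c \<and> u + v + w = s"
proof -
  consider "s \<le> a + b0 + c0" | "a + b0 + c0 < s" "s \<le> a + b + c0" | "a + b + c0 < s" by linarith
  thus ?thesis
  proof cases
    case 1
    show ?thesis
      by (rule exI[of _ "s - b0 - c0"], rule exI[of _ b0], rule exI[of _ c0]) (use 1 assms in linarith)
  next
    case 2
    show ?thesis
      by (rule exI[of _ a], rule exI[of _ "s - a - c0"], rule exI[of _ c0]) (use 2 assms in linarith)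
  next
    case 3
    show ?thesis
      by (rule exI[of _ a], rule exI[of _ b], rule exI[of _ "s - a - b"]) (use 3 assms in linarith)
  qed
qed

text \<open>
  The sum of \<open>l + 1\<close> multiples of 3 is a multiple of 3, and so is any of them.
\<close>

lemma sum_free_profile_zeros_le:
  assumes "sum_free_profile l (a, b, c)"
  shows "a \<le> l"
proof (rule ccontr)
  assume "\<not> a \<le> l"
  hence "\<not> solvable_profile (Suc l) 0 0"
    using sum_free_profileD[OF assms, of "Suc l" 0 0] by simp
  thus False by (simp add: solvable_profile_def)
qed

text \<open>
  As soon as \<open>l + 1 \<ge> 3\<close>, a set with all three residues has a subset of size \<open>l + 1\<close> with all three,
  and such a subset contains whatever residue its sum requires.
\<close>

lemma sum_free_profile_missing_residue:
  assumes free: "sum_free_profile l (a, b, c)" and l: "l \<ge> 2" and size: "Suc l \<le> a + b + c"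
  shows "a = 0 \<or> b = 0 \<or> c = 0"
proof (rule ccontr)
  assume "\<not> ?thesis"
  then obtain u v w where "1 \<le> u" "u \<le> a" "1 \<le> v" "v \<le> b" "1 \<le> w" "w \<le> c" "u + v + w = Suc l"
    using choose_subprofile[of 1 a 1 b 1 c "Suc l"] l size by auto
  thus False
    using sum_free_profileD[OF free] solvable_if_all_residues[of u v w] by simp
qed

text \<open>
  A set of elements of the residues \<open>p\<close> and \<open>q\<close>, both present, is unsolvable only if its negated sum
  is the third residue. Completing the same elements by one of residue \<open>p\<close> or by one of residue \<open>q\<close>
  gives different sums, so this cannot happen twice. The cases where only one residue is
  present at first are settled by the same inspection of residues.
\<close>

lemma solvable_profile_exchange:
  assumes "u + v > 0"
  shows "solvable_profile (Suc u) v 0 \<or> solvable_profile u (Suc v) 0"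
    and "solvable_profile (Suc u) 0 v \<or> solvable_profile u 0 (Suc v)"
    and "solvable_profile 0 (Suc u) v \<or> solvable_profile 0 u (Suc v)"
  using assms unfolding solvable_profile_iff_mod
  by (cases u rule: mod_3_cases; cases v rule: mod_3_cases; force simp: mod_Suc)+

text \<open>
  If two residues occur, omit one element of each; \<open>l\<close> elements of the rest can be completed to
  \<open>l + 1\<close> by either of them, so the exchange argument applies. For a single
  nonzero residue \<open>q\<close>, a solution amounts to \<open>l q \<equiv> q\<close>.
\<close>

lemma sum_free_profile_large:
  assumes free: "sum_free_profile l (a, b, c)" and l: "l \<ge> 2" and size: "Suc (Suc l) \<le> a + b + c"
  shows "a = 0" and "b = 0 \<or> c = 0" and "l mod 3 \<noteq> 1"
proof -
  have split: "\<exists>u v. Suc u \<le> p \<and> Suc v \<le> q \<and> u + v = l"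
    if "p > 0" "q > 0" "Suc (Suc l) \<le> p + q" for p q :: nat
    using that choose_subprofile[of 0 "p - 1" 0 "q - 1" 0 0 l] by force
  note D = sum_free_profileD[OF free]
  have ab: "a = 0 \<or> b = 0" if zero: "c = 0"
  proof (rule ccontr)
    assume "\<not> ?thesis"
    then obtain u v where "Suc u \<le> a" "Suc v \<le> b" "u + v = l"
      using split[of a b] size zero by auto
    thus False using D[of "Suc u" v 0] D[of u "Suc v" 0] solvable_profile_exchange(1)[of u v] l by simp
  qed
  have ac: "a = 0 \<or> c = 0" if zero: "b = 0"
  proof (rule ccontr)
    assume "\<not> ?thesis"
    then obtain u v where "Suc u \<le> a" "Suc v \<le> c" "u + v = l"
      using split[of a c] size zero by auto
    thus False using D[of "Suc u" 0 v] D[of u 0 "Suc v"] solvable_profile_exchange(2)[of u v] l by simp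
  qed
  have bc: "b = 0 \<or> c = 0" if zero: "a = 0"
  proof (rule ccontr)
    assume "\<not> ?thesis"
    then obtain u v where "Suc u \<le> b" "Suc v \<le> c" "u + v = l"
      using split[of b c] size zero by auto
    thus False using D[of 0 "Suc u" v] D[of 0 u "Suc v"] solvable_profile_exchange(3)[of u v] l by simp
  qed
  have "a \<le> l" by (rule sum_free_profile_zeros_le[OF free])
  with ab ac bc size sum_free_profile_missing_residue[OF free l]
  show a: "a = 0" and b: "b = 0 \<or> c = 0" by auto
  have "\<not> solvable_profile 0 (Suc l) 0 \<or> \<not> solvable_profile 0 0 (Suc l)"
    using D[of 0 "Suc l" 0] D[of 0 0 "Suc l"] a b size by auto
  thus "l mod 3 \<noteq> 1" by (auto simp: solvable_profile_iff_mod mod_Suc)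
qed

text \<open>
  A profile of size \<open>l + 1\<close> has no other subprofile of that size, so sum-freeness is the one condition
  on its sum. The condition excludes all three residues, and it fixes the remaining counts modulo 3.
  In the first case only the consequence for the multiples of 3 is recorded.
\<close>

lemma sum_free_profile_Suc_mod:
  assumes "sum_free_profile l (a, b, c)" and "l \<ge> 2" and size: "a + b + c = Suc l"
  shows "l mod 3 = 0 \<Longrightarrow> a mod 3 = 0"
    and "l mod 3 = 1 \<Longrightarrow> (a = 0 \<and> b mod 3 = 1 \<and> c mod 3 = 1) \<or>
           (a mod 3 = 1 \<and> b = 0 \<and> c mod 3 = 1) \<or> (a mod 3 = 1 \<and> b mod 3 = 1 \<and> c = 0)"
    and "l mod 3 = 2 \<Longrightarrow> (a = 0 \<and> b mod 3 = 0 \<and> c mod 3 = 0) \<or>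
           (a mod 3 = 2 \<and> b mod 3 = 1 \<and> c = 0) \<or> (a mod 3 = 2 \<and> b = 0 \<and> c mod 3 = 1)"
proof -
  have miss: "a = 0 \<or> b = 0 \<or> c = 0"
    using sum_free_profile_missing_residue[OF assms(1,2)] size by auto
  have free: "\<not> solvable_profile a b c"
    using assms(1) sum_free_profile_exact[OF size] by simp
  have mod: "((a mod 3 + b mod 3) mod 3 + c mod 3) mod 3 = Suc (l mod 3) mod 3"
    by (simp only: mod_add_eq mod_Suc_eq size)
  have pos: "a > 0 \<or> b > 0 \<or> c > 0" using size by auto
  note facts = free[unfolded solvable_profile_iff_mod] mod pos
  have "(l mod 3 = 0 \<longrightarrow> a mod 3 = 0) \<and>
    (l mod 3 = 1 \<longrightarrow> (a = 0 \<and> b mod 3 = 1 \<and> c mod 3 = 1) \<or>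
       (a mod 3 = 1 \<and> b = 0 \<and> c mod 3 = 1) \<or> (a mod 3 = 1 \<and> b mod 3 = 1 \<and> c = 0)) \<and>
    (l mod 3 = 2 \<longrightarrow> (a = 0 \<and> b mod 3 = 0 \<and> c mod 3 = 0) \<or>
       (a mod 3 = 2 \<and> b mod 3 = 1 \<and> c = 0) \<or> (a mod 3 = 2 \<and> b = 0 \<and> c mod 3 = 1))"
    using miss
  proof (elim disjE)
    assume "a = 0"
    thus ?thesis using facts
      by (cases b rule: mod_3_cases; cases c rule: mod_3_cases; cases l rule: mod_3_cases; simp)
  next
    assume "b = 0"
    thus ?thesis using facts
      by (cases a rule: mod_3_cases; cases c rule: mod_3_cases; cases l rule: mod_3_cases; simp)
  next
    assume "c = 0"
    thus ?thesis using facts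
      by (cases a rule: mod_3_cases; cases b rule: mod_3_cases; cases l rule: mod_3_cases; simp)
  qed
  thus "l mod 3 = 0 \<Longrightarrow> a mod 3 = 0"
    and "l mod 3 = 1 \<Longrightarrow> (a = 0 \<and> b mod 3 = 1 \<and> c mod 3 = 1) \<or>
           (a mod 3 = 1 \<and> b = 0 \<and> c mod 3 = 1) \<or> (a mod 3 = 1 \<and> b mod 3 = 1 \<and> c = 0)"
    and "l mod 3 = 2 \<Longrightarrow> (a = 0 \<and> b mod 3 = 0 \<and> c mod 3 = 0) \<or>
           (a mod 3 = 2 \<and> b mod 3 = 1 \<and> c = 0) \<or> (a mod 3 = 2 \<and> b = 0 \<and> c mod 3 = 1)"
    by simp_all
qed

text \<open>
  These are the optimal parts for \<open>l \<equiv> 1\<close> modulo 3.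
\<close>

lemma sum_free_profile_pair:
  assumes "p + q = Suc l" and "p mod 3 = 1" and "q mod 3 = 1"
  shows "sum_free_profile l (p, q, 0)" "sum_free_profile l (p, 0, q)" "sum_free_profile l (0, p, q)"
proof -
  have "\<not> solvable_profile p q 0" "\<not> solvable_profile p 0 q" "\<not> solvable_profile 0 p q"
    using assms by (auto simp: solvable_profile_iff_mod)
  thus "sum_free_profile l (p, q, 0)" "sum_free_profile l (p, 0, q)" "sum_free_profile l (0, p, q)"
    using assms(1) by (simp_all add: sum_free_profile_exact)
qed

section \<open>One summand or one part\<close>

text \<open>
  For \<open>l = 1\<close> a solution consists of two distinct congruent numbers, so each part has at most one
  element of every residue.
\<close>

lemma WS_3_l_1: "WS 3 k 1 = 3 * k"
proof (rule WS_eqI)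
  have "sum_free_profile 1 (1, 1, 1)"
    unfolding sum_free_profile_def solvable_profile_def by (auto simp: le_Suc_eq)
  thus "weak_Schur_admissible 3 k 1 (3 * k)"
    by (intro weak_Schur_admissible_3_intro[of "replicate k (1, 1, 1)"])
      (auto simp: sum_list_replicate_profile list_all_iff)
next
  show "\<not> weak_Schur_admissible 3 k 1 (Suc (3 * k))"
  proof
    assume "weak_Schur_admissible 3 k 1 (Suc (3 * k))"
    then obtain ps where ps: "length ps = k" "\<And>a b c. (a, b, c) \<in> set ps \<Longrightarrow> sum_free_profile 1 (a, b, c)"
      "sum_list ps = (Suc (3 * k) div 3, (Suc (3 * k) + 2) div 3, (Suc (3 * k) + 1) div 3)"
      using weak_Schur_admissible_3_obtain by metis
    have "b \<le> 1" if "(a, b, c) \<in> set ps" for a b c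
    proof (rule ccontr)
      assume "\<not> b \<le> 1"
      thus False using sum_free_profileD[OF ps(2)[OF that], of 0 2 0] by (simp add: solvable_profile_def)
    qed
    hence "sum_list (map (fst \<circ> snd) ps) \<le> 1 * length (filter (\<lambda>x. x > 0) (map (fst \<circ> snd) ps))"
      by (intro sum_list_le_support) auto
    also have "\<dots> \<le> k"
      using ps(1) length_filter_le[of "\<lambda>x. x > 0" "map (fst \<circ> snd) ps"] by simp
    finally have "sum_list (map (fst \<circ> snd) ps) \<le> k" .
    thus False using ps(3) unfolding sum_list_profile_components[of ps] by simp
  qed
qed simp

text \<open>
  The interval \<open>{1..l + 1}\<close> contains all three residues, since \<open>l + 1 \<ge> 3\<close>.
\<close>

lemma WS_3_k_1:
  assumes "l \<ge> 2"
  shows "WS 3 1 l = l"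
proof (rule WS_eqI)
  have "sum_free_profile l (l div 3, (l + 2) div 3, (l + 1) div 3)"
    by (rule sum_free_profile_small) (simp only: div_3_sum)
  thus "weak_Schur_admissible 3 1 l l"
    unfolding weak_Schur_admissible_3_iff
    by (intro exI[of _ "[(l div 3, (l + 2) div 3, (l + 1) div 3)]"]) simp
next
  show "\<not> weak_Schur_admissible 3 1 l (Suc l)"
  proof
    assume "weak_Schur_admissible 3 1 l (Suc l)"
    then obtain ps where ps: "length ps = 1" "\<And>a b c. (a, b, c) \<in> set ps \<Longrightarrow> sum_free_profile l (a, b, c)"
      "sum_list ps = (Suc l div 3, (Suc l + 2) div 3, (Suc l + 1) div 3)"
      using weak_Schur_admissible_3_obtain by metis
    from ps(1,3) have "ps = [(Suc l div 3, (Suc l + 2) div 3, (Suc l + 1) div 3)]"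
      by (auto simp: length_Suc_conv)
    hence "sum_free_profile l (Suc l div 3, (Suc l + 2) div 3, (Suc l + 1) div 3)"
      using ps(2) by simp
    thus False
      using sum_free_profile_missing_residue[OF _ assms] assms div_3_sum[of "Suc l"]
      by fastforce
  qed
qed simp

section \<open>Two parts\<close>

lemma two_profiles_obtain:
  assumes "weak_Schur_admissible 3 2 l n"
  obtains a b c a' b' c' where "sum_free_profile l (a, b, c)" "sum_free_profile l (a', b', c')"
    "a + a' = n div 3" "b + b' = (n + 2) div 3" "c + c' = (n + 1) div 3"
proof -
  obtain ps where ps: "length ps = 2" "\<And>a b c. (a, b, c) \<in> set ps \<Longrightarrow> sum_free_profile l (a, b, c)"
      "sum_list ps = (n div 3, (n + 2) div 3, (n + 1) div 3)"
    using weak_Schur_admissible_3_obtain[OF assms] by metis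
  obtain p q where "ps = [p, q]" using ps(1) by (auto simp: length_Suc_conv numeral_2_eq_2)
  moreover obtain a b c where "p = (a, b, c)" by (metis prod_cases3)
  moreover obtain a' b' c' where "q = (a', b', c')" by (metis prod_cases3)
  ultimately show ?thesis by (intro that[of a b c a' b' c']) (use ps(2,3) in auto)
qed

text \<open>
  Only a part with a single nonzero residue can be larger, and the interval has too few elements
  of that residue in the situations considered below.
\<close>

lemma sum_free_profile_size_le:
  assumes "sum_free_profile l (a, b, c)" and "l \<ge> 2" and "b \<le> l + 1" "c \<le> l + 1"
  shows "a + b + c \<le> l + 1"
  using sum_free_profile_large[OF assms(1,2)] assms(3,4) by force

lemma two_parts_bound:
  assumes "l \<ge> 2"
  shows "\<not> weak_Schur_admissible 3 2 l (2 * l + 3)"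
proof
  assume "weak_Schur_admissible 3 2 l (2 * l + 3)"
  then obtain a b c a' b' c' where free: "sum_free_profile l (a, b, c)" "sum_free_profile l (a', b', c')"
    and sums: "a + a' = (2 * l + 3) div 3" "b + b' = (2 * l + 3 + 2) div 3" "c + c' = (2 * l + 3 + 1) div 3"
    by (rule two_profiles_obtain)
  have "a + b + c \<le> l + 1" "a' + b' + c' \<le> l + 1"
    using sums assms by (intro sum_free_profile_size_le[OF free(1)] sum_free_profile_size_le[OF free(2)]; linarith)+
  thus False using sums div_3_sum[of "2 * l + 3"] by linarith
qed

text \<open>
  Both parts would have exactly \<open>l + 1\<close> elements. The counts of each are prescribed modulo 3, while
  their sums are the counts of \<open>{1..2 l + 2}\<close>, whose residues modulo 3 depend on \<open>l\<close> modulo 9.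
\<close>

lemma two_parts_mod_9_obstruction:
  assumes "l \<ge> 2" and "l mod 9 \<notin> {0, 1, 5}"
  shows "\<not> weak_Schur_admissible 3 2 l (2 * l + 2)"
proof
  assume "weak_Schur_admissible 3 2 l (2 * l + 2)"
  then obtain a b c a' b' c' where free: "sum_free_profile l (a, b, c)" "sum_free_profile l (a', b', c')"
    and sums: "a + a' = (2 * l + 2) div 3" "b + b' = (2 * l + 2 + 2) div 3" "c + c' = (2 * l + 2 + 1) div 3"
    by (rule two_profiles_obtain)
  have "a + b + c \<le> l + 1" "a' + b' + c' \<le> l + 1"
    using sums assms by (intro sum_free_profile_size_le[OF free(1)] sum_free_profile_size_le[OF free(2)]; linarith)+
  hence size: "a + b + c = Suc l" "a' + b' + c' = Suc l"
    using sums div_3_sum[of "2 * l + 2"] by linarith+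
  note mods = sum_free_profile_Suc_mod[OF free(1) assms(1) size(1)]
    sum_free_profile_Suc_mod[OF free(2) assms(1) size(2)]
  define t where "t = l div 9"
  have l: "l = 9 * t + l mod 9" by (simp add: t_def)
  define A where "A = (2 * l + 2) div 3"
  define B where "B = (2 * l + 2 + 2) div 3"
  define C where "C = (2 * l + 2 + 1) div 3"
  note ABC = A_def B_def C_def
  have sums': "a + a' = A" "b + b' = B" "c + c' = C" using sums by (simp_all only: ABC)
  hence sums_mod: "(a mod 3 + a' mod 3) mod 3 = A mod 3" "(b mod 3 + b' mod 3) mod 3 = B mod 3"
    "(c mod 3 + c' mod 3) mod 3 = C mod 3"
    by (simp_all only: mod_add_eq)
  have "l mod 9 \<in> {2, 3, 4, 6, 7, 8}"
    using assms(2) mod_less_divisor[of 9 l] by (simp; linarith)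
  then consider "l = 9 * t + 3" | "l = 9 * t + 6" | "l = 9 * t + 4" | "l = 9 * t + 7" |
    "l = 9 * t + 2" | "l = 9 * t + 8"
    using l by auto
  thus False
  proof cases
    case 1
    hence lm: "l mod 3 = 0" by presburger
    have res: "A mod 3 = 2"
      unfolding ABC 1 by (simp; presburger)+
    show False using mods(1,4)[OF lm] sums_mod res by simp
  next
    case 2
    hence lm: "l mod 3 = 0" by presburger
    have res: "A mod 3 = 1"
      unfolding ABC 2 by (simp; presburger)+
    show False using mods(1,4)[OF lm] sums_mod res by simp
  next
    case 3
    hence lm: "l mod 3 = 1" by presburger
    have res: "A mod 3 = 0" "B mod 3 = 1" "C mod 3 = 0"
      unfolding ABC 3 by (simp; presburger)+
    from mods(2,5)[OF lm] sums' sums_mod res show False by (elim disjE) simp_all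
  next
    case 4
    hence lm: "l mod 3 = 1" by presburger
    have res: "A mod 3 = 2" "B mod 3 = 0" "C mod 3 = 2"
      unfolding ABC 4 by (simp; presburger)+
    have "B > 0" unfolding ABC 4 by simp
    with mods(2,5)[OF lm] sums' sums_mod res show False by (elim disjE) simp_all
  next
    case 5
    hence lm: "l mod 3 = 2" by presburger
    have res: "A mod 3 = 2" "B mod 3 = 2" "C mod 3 = 2"
      unfolding ABC 5 by (simp; presburger)+
    from mods(3,6)[OF lm] sums' sums_mod res show False by (elim disjE) simp_all
  next
    case 6
    hence lm: "l mod 3 = 2" by presburger
    have res: "A mod 3 = 0" "B mod 3 = 0" "C mod 3 = 0"
      unfolding ABC 6 by (simp; presburger)+
    have "A > 0" unfolding ABC 6 by simp
    with mods(3,6)[OF lm] sums' sums_mod res show False by (elim disjE) simp_all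
  qed
qed

text \<open>
  For these two values the interval has too few elements of each residue to form even one sum-free
  part of size \<open>l + 1\<close>; already one such part would be required.
\<close>

lemma two_parts_small_obstruction:
  assumes "l \<in> {2, 4}"
  shows "\<not> weak_Schur_admissible 3 2 l (2 * l + 1)"
proof
  assume "weak_Schur_admissible 3 2 l (2 * l + 1)"
  then obtain a b c a' b' c' where free: "sum_free_profile l (a, b, c)" "sum_free_profile l (a', b', c')"
    and sums: "a + a' = (2 * l + 1) div 3" "b + b' = (2 * l + 1 + 2) div 3" "c + c' = (2 * l + 1 + 1) div 3"
    by (rule two_profiles_obtain)
  have l: "l \<ge> 2" using assms by auto
  have no: "a + b + c \<le> l" if "sum_free_profile l (a, b, c)" "a \<le> (2 * l + 1) div 3"
    "b \<le> (2 * l + 1 + 2) div 3" "c \<le> (2 * l + 1 + 1) div 3" for a b c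
  proof (rule ccontr)
    assume "\<not> a + b + c \<le> l"
    moreover have "a + b + c \<le> l + 1"
      using that l by (intro sum_free_profile_size_le[OF that(1)]) linarith+
    ultimately have size: "a + b + c = Suc l" by simp
    consider "l = 2" | "l = 4" using assms by auto
    thus False
    proof cases
      case 1
      have "a \<le> 1" "b \<le> 2" "c \<le> 2" using that 1 by simp_all
      thus False using sum_free_profile_Suc_mod(3)[OF that(1) l size] size 1 by auto
    next
      case 2
      have "a \<le> 3" "b \<le> 3" "c \<le> 3" using that 2 by simp_all
      moreover have "x = 1" if "x \<le> 3" "x mod 3 = 1" for x :: nat using that by (cases "x = 3") simp_all
      ultimately have "a mod 3 = 1 \<longrightarrow> a = 1" "b mod 3 = 1 \<longrightarrow> b = 1" "c mod 3 = 1 \<longrightarrow> c = 1"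
        by blast+
      moreover have "l mod 3 = 1" using 2 by simp
      ultimately show False
        using sum_free_profile_Suc_mod(2)[OF that(1) l size, OF \<open>l mod 3 = 1\<close>] size 2
        by (elim disjE) simp_all
    qed
  qed
  have "a + b + c \<le> l" "a' + b' + c' \<le> l" using sums by (intro no free; linarith)+
  thus False using sums div_3_sum[of "2 * l + 1"] by linarith
qed

text \<open>
  One residue is divided between the two parts in such a way that their sizes agree and both meet
  the conditions modulo 3; each of the other two residues stays in one part.
\<close>

lemma two_full_parts_construction:
  assumes "l \<ge> 2" and "[l = 0] (mod 9) \<or> [l = 1] (mod 9) \<or> [l = 5] (mod 9)"
  shows "weak_Schur_admissible 3 2 l (2 * l + 2)"
proof -
  define t where "t = l div 9"
  have "l = 9 * t + l mod 9" by (simp add: t_def)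
  with assms(2) consider "l = 9 * t" "t > 0" | "l = 9 * t + 1" | "l = 9 * t + 5"
    using assms(1) by (auto simp: cong_def)
  thus ?thesis
  proof cases
    case 1
    show ?thesis
      by (rule weak_Schur_admissible_3_intro[of "[(3*t, 6*t+1, 0), (3*t, 0, 6*t+1)]"];
        auto simp: 1 sum_free_profile_exact solvable_profile_iff_mod; presburger)
  next
    case 2
    show ?thesis
      by (rule weak_Schur_admissible_3_intro[of "[(6*t+1, 3*t+1, 0), (0, 3*t+1, 6*t+1)]"];
        auto simp: 2 intro!: sum_free_profile_pair; presburger)
  next
    case 3
    show ?thesis
      by (rule weak_Schur_admissible_3_intro[of "[(3*t+2, 6*t+4, 0), (3*t+2, 0, 6*t+4)]"];
        auto simp: 3 sum_free_profile_exact solvable_profile_iff_mod; presburger)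
  qed
qed

text \<open>
  A part of size \<open>l + 1\<close> with prescribed residues, and a remainder of size \<open>l\<close>, which is sum-free
  for any counts. If \<open>l\<close> is 2 or 4 modulo 9, the first part needs enough elements of two residues,
  which requires \<open>l\<close> to be at least 11 or 13.
\<close>

lemma two_parts_one_full_construction:
  assumes "l = 3 \<or> l \<ge> 5" and "l mod 9 \<in> {2, 3, 4, 6, 7, 8}"
  shows "weak_Schur_admissible 3 2 l (2 * l + 1)"
proof -
  define t where "t = l div 9"
  have "l = 9 * t + l mod 9" by (simp add: t_def)
  then consider "l = 9 * t + 2" "t > 0" | "l = 9 * t + 3" | "l = 9 * t + 4" "t > 0" |
    "l = 9 * t + 6" | "l = 9 * t + 7" | "l = 9 * t + 8"
    using assms by fastforce
  thus ?thesis
  proof cases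
    case 1
    then obtain s where "t = Suc s" by (cases t) auto
    show ?thesis
      by (rule weak_Schur_admissible_3_intro[of "[(3*s+5, 6*s+7, 0), (3*s+2, 1, 6*s+8)]"];
        auto simp: 1 \<open>t = Suc s\<close> sum_free_profile_exact sum_free_profile_small solvable_profile_iff_mod; presburger)
  next
    case 2
    show ?thesis
      by (rule weak_Schur_admissible_3_intro[of "[(0, 6*t+2, 3*t+2), (6*t+2, 1, 3*t)]"];
        auto simp: 2 sum_free_profile_exact sum_free_profile_small solvable_profile_iff_mod; presburger)
  next
    case 3
    then obtain s where "t = Suc s" by (cases t) auto
    show ?thesis
      by (rule weak_Schur_admissible_3_intro[of "[(6*s+7, 3*s+7, 0), (2, 3*s+2, 6*s+9)]"];
        auto simp: 3 \<open>t = Suc s\<close> sum_free_profile_exact sum_free_profile_small solvable_profile_iff_mod; presburger)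
  next
    case 4
    show ?thesis
      by (rule weak_Schur_admissible_3_intro[of "[(0, 6*t+5, 3*t+2), (6*t+4, 0, 3*t+2)]"];
        auto simp: 4 sum_free_profile_exact sum_free_profile_small solvable_profile_iff_mod; presburger)
  next
    case 5
    show ?thesis
      by (rule weak_Schur_admissible_3_intro[of "[(6*t+4, 3*t+4, 0), (1, 3*t+1, 6*t+5)]"];
        auto simp: 5 sum_free_profile_exact sum_free_profile_small solvable_profile_iff_mod; presburger)
  next
    case 6
    show ?thesis
      by (rule weak_Schur_admissible_3_intro[of "[(0, 6*t+6, 3*t+3), (6*t+5, 0, 3*t+3)]"];
        auto simp: 6 sum_free_profile_exact sum_free_profile_small solvable_profile_iff_mod; presburger)
  qed
qed

lemma two_parts_small_construction:
  assumes "l \<in> {2, 4}"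
  shows "weak_Schur_admissible 3 2 l (2 * l)"
proof -
  have "weak_Schur_admissible 3 2 2 4"
    by (rule weak_Schur_admissible_3_intro[of "[(1, 1, 0), (0, 1, 1)]"])
      (simp_all add: sum_free_profile_small)
  moreover have "weak_Schur_admissible 3 2 4 8"
    by (rule weak_Schur_admissible_3_intro[of "[(2, 2, 0), (0, 1, 3)]"])
      (simp_all add: sum_free_profile_small)
  ultimately show ?thesis using assms by auto
qed

section \<open>At least three parts, l not congruent to 1 modulo 3\<close>

text \<open>
  Parts with a single nonzero residue can be arbitrarily large, so only the multiples of 3 limit
  the construction.
\<close>

lemma construction_not_1_mod_3:
  assumes "k \<ge> 3" and "l mod 3 \<noteq> 1"
  shows "weak_Schur_admissible 3 k l (3 * (k - 2) * l + 2)"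
proof (rule weak_Schur_admissible_3_intro)
  let ?N = "(k - 2) * l + 1"
  let ?ps = "(0, ?N, 0) # (0, 0, ?N) # replicate (k - 2) (l, 0, 0)"
  show "length ?ps = k" using assms by simp
  show "list_all (sum_free_profile l) ?ps"
    using assms sum_free_profile_monochromatic by (simp add: list_all_iff sum_free_profile_small)
  show "case sum_list ?ps of (A, B, C) \<Rightarrow>
    A \<le> C \<and> C \<le> B \<and> B \<le> A + 1 \<and> 3 * (k - 2) * l + 2 = A + B + C"
    by (simp add: sum_list_replicate_profile)
qed

text \<open>
  There are \<open>l + 1\<close> elements of each residue, so every part is confined to \<open>l + 1\<close> elements and has
  exactly this size. For \<open>l \<equiv> 0\<close> all counts of multiples of 3 are divisible by 3, but their sum is
  \<open>l + 1\<close>. For \<open>l \<equiv> 2\<close> the residues force the multiples of 3 to occur in all three parts, each with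
  one further residue, which must be the same in all parts; the remaining residue then has no place.
\<close>

lemma three_parts_obstruction:
  assumes l: "l \<ge> 2" "l mod 3 \<noteq> 1"
  shows "\<not> weak_Schur_admissible 3 3 l (3 * l + 3)"
proof
  assume "weak_Schur_admissible 3 3 l (3 * l + 3)"
  then obtain ps where ps: "length ps = 3" "\<And>a b c. (a, b, c) \<in> set ps \<Longrightarrow> sum_free_profile l (a, b, c)"
    "sum_list ps = ((3 * l + 3) div 3, (3 * l + 3 + 2) div 3, (3 * l + 3 + 1) div 3)"
    using weak_Schur_admissible_3_obtain by metis
  have sum: "sum_list ps = (l + 1, l + 1, l + 1)" unfolding ps(3) by simp
  obtain p q r where pqr: "ps = [p, q, r]" using ps(1) by (auto simp: length_Suc_conv numeral_3_eq_3)
  obtain a1 b1 c1 where p: "p = (a1, b1, c1)" by (metis prod_cases3)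
  obtain a2 b2 c2 where q: "q = (a2, b2, c2)" by (metis prod_cases3)
  obtain a3 b3 c3 where r: "r = (a3, b3, c3)" by (metis prod_cases3)
  have sums: "a1 + a2 + a3 = l + 1" "b1 + b2 + b3 = l + 1" "c1 + c2 + c3 = l + 1"
    using sum by (simp_all add: pqr p q r)
  have free: "sum_free_profile l (a1, b1, c1)" "sum_free_profile l (a2, b2, c2)"
    "sum_free_profile l (a3, b3, c3)" using ps(2) by (simp_all add: pqr p q r)
  have "a1 + b1 + c1 \<le> l + 1" "a2 + b2 + c2 \<le> l + 1" "a3 + b3 + c3 \<le> l + 1"
    using sum_free_profile_size_le[OF free(1) l(1)] sum_free_profile_size_le[OF free(2) l(1)]
      sum_free_profile_size_le[OF free(3) l(1)] sums by simp_all
  hence size: "a1 + b1 + c1 = Suc l" "a2 + b2 + c2 = Suc l" "a3 + b3 + c3 = Suc l"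
    using sums by linarith+
  note m1 = sum_free_profile_Suc_mod[OF free(1) l(1) size(1)]
  note m2 = sum_free_profile_Suc_mod[OF free(2) l(1) size(2)]
  note m3 = sum_free_profile_Suc_mod[OF free(3) l(1) size(3)]
  have sums_mod: "((a1 mod 3 + a2 mod 3) mod 3 + a3 mod 3) mod 3 = Suc (l mod 3) mod 3"
    "((b1 mod 3 + b2 mod 3) mod 3 + b3 mod 3) mod 3 = Suc (l mod 3) mod 3"
    "((c1 mod 3 + c2 mod 3) mod 3 + c3 mod 3) mod 3 = Suc (l mod 3) mod 3"
    by (simp_all only: mod_add_eq mod_Suc_eq sums) simp_all
  consider "l mod 3 = 0" | "l mod 3 = 2" using l(2) by linarith
  thus False
  proof cases
    case 1
    hence "((a1 mod 3 + a2 mod 3) mod 3 + a3 mod 3) mod 3 = 0" using m1(1) m2(1) m3(1) by simp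
    thus False using sums_mod(1) 1 by (simp add: mod_Suc)
  next
    case 2
    have "Suc (l mod 3) mod 3 = 0" using 2 by simp
    from m1(3)[OF 2] m2(3)[OF 2] m3(3)[OF 2] sums sums_mod[unfolded this] show False
      by (elim disjE) simp_all
  qed
qed

text \<open>
  Let \<open>h\<close> be the number of parts that contain multiples of 3. Since \<open>(k - 2) l + 1\<close> multiples of 3 do
  not fit into \<open>k - 2\<close> parts, \<open>h \<ge> k - 1\<close>; these \<open>h\<close> parts have at most \<open>l + 1\<close> elements each, and at
  most one part is left, whose size is bounded by the number \<open>N\<close> of elements of one residue.
\<close>

lemma obstruction_not_1_mod_3:
  assumes k: "k \<ge> 3" and l: "l \<ge> 2" "l mod 3 \<noteq> 1"
  shows "\<not> weak_Schur_admissible 3 k l (3 * (k - 2) * l + 3)"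
proof (cases "k = 3")
  case True
  thus ?thesis using three_parts_obstruction[OF l] by simp
next
  case False
  define j where "j = k - 4"
  have j: "k = j + 4" using False k by (simp add: j_def)
  define N where "N = (j + 2) * l + 1"
  have n: "3 * (k - 2) * l + 3 = 3 * N" by (simp add: j N_def algebra_simps)
  show ?thesis
  proof
    assume "weak_Schur_admissible 3 k l (3 * (k - 2) * l + 3)"
    then obtain ps where ps: "length ps = k" "\<And>a b c. (a, b, c) \<in> set ps \<Longrightarrow> sum_free_profile l (a, b, c)"
      "sum_list ps = (3 * N div 3, (3 * N + 2) div 3, (3 * N + 1) div 3)"
      using weak_Schur_admissible_3_obtain unfolding n by metis
    have sum: "sum_list ps = (N, N, N)" unfolding ps(3) by (simp; presburger)
    define h where "h = length (filter (\<lambda>x. x > 0) (map fst ps))"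
    have "h \<le> k" unfolding h_def using ps(1) length_filter_le[of "\<lambda>x. x > 0" "map fst ps"] by simp
    have lN: "l + 1 \<le> N" by (simp add: N_def)
    have size: "a + b + c \<le> (if a > 0 then l + 1 else N)" if p: "(a, b, c) \<in> set ps" for a b c
    proof -
      have "b \<le> N" "c \<le> N" using profile_le_sum_list[OF p sum] by simp_all
      thus ?thesis using sum_free_profile_large(1,2)[OF ps(2)[OF p] l(1)] lN by fastforce
    qed
    have total: "3 * N \<le> (l + 1) * h + N * (k - h)"
      using total_le_by_zero_support[OF sum size] ps(1) by (simp add: h_def)
    have "sum_list (map fst ps) \<le> l * h" unfolding h_def
      using sum_free_profile_zeros_le[OF ps(2)] by (intro sum_list_le_support) auto
    hence "N \<le> l * h" using sum sum_list_profile_components[of ps] by simp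
    hence "(j + 2) * l < h * l" by (simp add: N_def mult.commute)
    hence "j + 2 < h" by (simp only: mult_less_cancel2)
    with \<open>h \<le> k\<close> j consider "h = j + 3" | "h = j + 4" by linarith
    thus False
    proof cases
      case 1
      hence "2 * N \<le> (l + 1) * (j + 3)" using total j by simp
      hence "l * j + l \<le> j + 1" by (simp add: N_def algebra_simps)
      moreover have "2 * (j + 1) \<le> l * (j + 1)" using l(1) by (intro mult_le_mono1)
      ultimately show False by (simp add: algebra_simps)
    next
      case 2
      hence "3 * N \<le> (l + 1) * (j + 4)" using total j by simp
      hence "2 * (l * j) + 2 * l \<le> j + 1" by (simp add: N_def algebra_simps)
      moreover have "2 * (j + 1) \<le> l * (j + 1)" using l(1) by (intro mult_le_mono1)
      ultimately show False by (simp add: algebra_simps)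
    qed
  qed
qed

section \<open>At least three parts, l congruent to 1 modulo 3\<close>

lemma obstruction_1_mod_3:
  assumes "l \<ge> 2" and "l mod 3 = 1"
  shows "\<not> weak_Schur_admissible 3 k l (Suc (k * (l + 1)))"
proof
  assume "weak_Schur_admissible 3 k l (Suc (k * (l + 1)))" (is "weak_Schur_admissible 3 k l ?n")
  then obtain ps where ps: "length ps = k" "\<And>a b c. (a, b, c) \<in> set ps \<Longrightarrow> sum_free_profile l (a, b, c)"
    "sum_list ps = (?n div 3, (?n + 2) div 3, (?n + 1) div 3)"
    using weak_Schur_admissible_3_obtain by metis
  have "a + b + c \<le> l + 1" if "(a, b, c) \<in> set ps" for a b c
    using sum_free_profile_large(3)[OF ps(2)[OF that] assms(1)] assms(2) by linarith
  from total_le[OF ps(3) this] show False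
    using div_3_sum[of ?n] ps(1) by (simp add: algebra_simps)
qed

text \<open>
  Passing from \<open>n\<close> to \<open>n + 3 (l + 1)\<close> adds \<open>l + 1\<close> elements of every residue, and a cyclic
  arrangement of the pairs \<open>(1, l)\<close> distributes these over three parts.
\<close>

lemma add_three_full_parts:
  assumes "l mod 3 = 1" and "weak_Schur_admissible 3 k l n"
  shows "weak_Schur_admissible 3 (k + 3) l (n + 3 * (l + 1))"
proof -
  obtain ps where ps: "length ps = k" "\<And>p. p \<in> set ps \<Longrightarrow> sum_free_profile l p"
    "sum_list ps = (n div 3, (n + 2) div 3, (n + 1) div 3)"
    using assms(2) unfolding weak_Schur_admissible_3_iff by blast
  let ?qs = "[(1, l, 0), (0, 1, l), (l, 0, 1)]"
  show ?thesis
    unfolding weak_Schur_admissible_3_iff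
  proof (intro exI[of _ "ps @ ?qs"] conjI)
    show "\<forall>p\<in>set (ps @ ?qs). sum_free_profile l p"
      using ps(2) assms(1) by (auto intro!: sum_free_profile_pair)
    have "(n + 3 * (l + 1)) div 3 = n div 3 + (l + 1)"
      "(n + 3 * (l + 1) + 2) div 3 = (n + 2) div 3 + (l + 1)"
      "(n + 3 * (l + 1) + 1) div 3 = (n + 1) div 3 + (l + 1)" by presburger+
    thus "sum_list (ps @ ?qs) = ((n + 3 * (l + 1)) div 3, (n + 3 * (l + 1) + 2) div 3,
      (n + 3 * (l + 1) + 1) div 3)"
      using ps(3) by simp
  qed (use ps(1) in simp)
qed

lemma add_multiple_of_three_full_parts:
  assumes "l mod 3 = 1" and "weak_Schur_admissible 3 k l (k * (l + 1))"
  shows "weak_Schur_admissible 3 (k + 3 * j) l ((k + 3 * j) * (l + 1))"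
proof (induction j)
  case (Suc j)
  have "(k + 3 * Suc j) * (l + 1) = (k + 3 * j) * (l + 1) + 3 * (l + 1)"
    by (simp add: algebra_simps)
  thus ?case using add_three_full_parts[OF assms(1) Suc.IH] by (simp add: ac_simps)
qed (use assms in simp)

lemma four_full_parts_construction:
  assumes "l mod 9 = 1 \<or> l mod 9 = 7" and "l \<ge> 2"
  shows "weak_Schur_admissible 3 4 l (4 * (l + 1))"
proof -
  define t where "t = l div 9"
  have "l = 9 * t + l mod 9" by (simp add: t_def)
  with assms(1) consider "l = 9 * t + 1" | "l = 9 * t + 7" by metis
  thus ?thesis
  proof cases
    case 1
    show ?thesis
      by (rule weak_Schur_admissible_3_intro
        [of "[(0, 3*t+1, 6*t+1), (0, 6*t+1, 3*t+1), (6*t+1, 3*t+1, 0), (6*t+1, 0, 3*t+1)]"];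
        auto simp: 1 intro!: sum_free_profile_pair; presburger)
  next
    case 2
    show ?thesis
      by (rule weak_Schur_admissible_3_intro
        [of "[(3*t+4, 6*t+4, 0), (3*t+1, 6*t+7, 0), (3*t+4, 0, 6*t+4), (3*t+1, 0, 6*t+7)]"];
        auto simp: 2 intro!: sum_free_profile_pair; presburger)
  qed
qed

text \<open>
  The counts of all parts are congruent to 1, so the counts of \<open>{1..5 l + 5}\<close> tell modulo 3 how many
  of the five parts contain each residue; the witnesses realise one of the possible distributions.
\<close>

lemma five_full_parts_construction:
  assumes "l mod 3 = 1" and "l \<ge> 2"
  shows "weak_Schur_admissible 3 5 l (5 * (l + 1))"
proof -
  define t where "t = l div 9"
  have "l = 9 * t + l mod 9" by (simp add: t_def)
  moreover have "l mod 9 = 1 \<or> l mod 9 = 4 \<or> l mod 9 = 7" using assms(1) by presburger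
  ultimately consider "l = 9 * t + 1" | "l = 9 * t + 4" | "l = 9 * t + 7" by metis
  thus ?thesis
  proof cases
    case 1
    hence "[l = 1] (mod 9)" by (simp add: cong_def)
    hence "weak_Schur_admissible 3 2 l (2 * (l + 1))"
      using two_full_parts_construction[OF assms(2)] by simp
    from add_multiple_of_three_full_parts[OF assms(1) this, of 1] show ?thesis by simp
  next
    case 2
    show ?thesis
      by (rule weak_Schur_admissible_3_intro
        [of "[(0, 6*t+4, 3*t+1), (0, 6*t+4, 3*t+1), (0, 3*t+1, 6*t+4),
              (6*t+4, 0, 3*t+1), (9*t+4, 0, 1)]"];
        auto simp: 2 intro!: sum_free_profile_pair; presburger)
  next
    case 3
    show ?thesis
      by (rule weak_Schur_admissible_3_intro
        [of "[(3*t+1, 6*t+7, 0), (0, 9*t+7, 1), (3*t+4, 0, 6*t+4), (3*t+4, 0, 6*t+4),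
              (6*t+4, 0, 3*t+4)]"];
        auto simp: 3 intro!: sum_free_profile_pair; presburger)
  qed
qed

text \<open>
  For \<open>l \<equiv> 4\<close> modulo 9 four parts do not suffice as a starting point for \<open>k \<equiv> 1\<close> modulo 3, so the
  construction starts from seven.
\<close>

lemma seven_full_parts_construction:
  assumes "l mod 9 = 4"
  shows "weak_Schur_admissible 3 7 l (7 * (l + 1))"
proof -
  define t where "t = l div 9"
  have l: "l = 9 * t + 4" using assms unfolding t_def by presburger
  show ?thesis
    by (rule weak_Schur_admissible_3_intro
      [of "[(0, 1, 9*t+4), (0, 3*t+1, 6*t+4), (3*t+1, 0, 6*t+4), (6*t+4, 3*t+1, 0),
            (6*t+4, 3*t+1, 0), (3*t+1, 6*t+4, 0), (3*t+1, 6*t+4, 0)]"];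
        auto simp: l intro!: sum_free_profile_pair; presburger)
qed

text \<open>
  Every \<open>k\<close> is reached in steps of three from the empty partition, from four or seven parts, or
  from five parts.
\<close>

lemma construction_1_mod_3:
  assumes "l mod 3 = 1" and "l \<ge> 2" and "k = 3 \<or> k \<ge> 5"
  shows "weak_Schur_admissible 3 k l (k * (l + 1))"
proof -
  have from_base: "weak_Schur_admissible 3 k l (k * (l + 1))"
    if "weak_Schur_admissible 3 b l (b * (l + 1))" "b \<le> k" "k mod 3 = b mod 3" for b
  proof -
    have "3 dvd k - b" using that(2,3) by (simp flip: mod_eq_dvd_iff_nat)
    hence "k = b + 3 * ((k - b) div 3)" using that(2) by simp
    thus ?thesis using add_multiple_of_three_full_parts[OF assms(1) that(1), of "(k - b) div 3"] by simp
  qed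
  consider "k mod 3 = 0" | "k mod 3 = 1" "k \<ge> 7" | "k mod 3 = 2" "k \<ge> 5"
  proof (cases k rule: mod_3_cases)
    case 2
    hence "k \<notin> {3, 5, 6}" by auto
    with assms(3) have "k \<ge> 7" by auto
    with 2 that(2) show ?thesis by blast
  next
    case 3
    hence "k \<noteq> 3" by auto
    with assms(3) 3 that(3) show ?thesis by blast
  qed (use that in blast)
  thus ?thesis
  proof cases
    case 1
    show ?thesis using from_base[of 0] 1 weak_Schur_admissible_0[of 3 0 l] by simp
  next
    case 2
    have "l mod 9 = 4 \<or> l mod 9 = 1 \<or> l mod 9 = 7" using assms(1) by presburger
    thus ?thesis using from_base[of 7] from_base[of 4] 2 seven_full_parts_construction four_full_parts_construction assms(2) by fastforce
  next
    case 3
    show ?thesis using from_base[of 5] 3 five_full_parts_construction[OF assms(1,2)] by simp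
  qed
qed

lemma four_parts_construction_minus_one:
  assumes "l mod 9 = 4"
  shows "weak_Schur_admissible 3 4 l (4 * l + 3)"
proof -
  define t where "t = l div 9"
  have l: "l = 9 * t + 4" using assms unfolding t_def by presburger
  show ?thesis
    by (rule weak_Schur_admissible_3_intro
      [of "[(3*t+1, 6*t+4, 0), (0, 3*t+1, 6*t+4), (6*t+4, 0, 3*t+1), (3*t+1, 3*t+2, 3*t+1)]"];
        auto simp: l sum_free_profile_small intro!: sum_free_profile_pair; presburger)
qed

text \<open>
  Parts with exactly one missing residue are counted twice when the occurrences of the residues are
  added up.
\<close>

lemma support_count:
  fixes ps :: "(nat \<times> nat \<times> nat) list"
  assumes "\<And>a b c. (a, b, c) \<in> set ps \<Longrightarrow>
    (a = 0 \<and> b > 0 \<and> c > 0) \<or> (a > 0 \<and> b = 0 \<and> c > 0) \<or> (a > 0 \<and> b > 0 \<and> c = 0)"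
  shows "length (filter (\<lambda>x. x > 0) (map fst ps)) + length (filter (\<lambda>x. x > 0) (map (fst \<circ> snd) ps)) +
    length (filter (\<lambda>x. x > 0) (map (snd \<circ> snd) ps)) = 2 * length ps"
  using assms
proof (induction ps)
  case (Cons p ps)
  obtain a b c where p: "p = (a, b, c)" by (metis prod_cases3)
  have IH: "length (filter (\<lambda>x. x > 0) (map fst ps)) + length (filter (\<lambda>x. x > 0) (map (fst \<circ> snd) ps)) +
    length (filter (\<lambda>x. x > 0) (map (snd \<circ> snd) ps)) = 2 * length ps"
    by (rule Cons.IH) (use Cons.prems in auto)
  have "(a, b, c) \<in> set (p # ps)" by (simp add: p)
  from Cons.prems[OF this] IH show ?case by (auto simp: p comp_def)
qed simp

text \<open>
  All four parts would have exactly \<open>l + 1\<close> elements with two residues each, hence 8 occurrences of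
  residues in total. The residues 1 and 2 have \<open>12 t + 7\<close> elements, so each of them occurs in 1 or 4
  parts, the number of its parts being congruent to 1; not in 1, because a part is too small for
  \<open>12 t + 7\<close> elements. But then 4 + 4 = 8 leaves no part for the multiples of 3.
\<close>

lemma four_parts_obstruction:
  assumes "l mod 9 = 4"
  shows "\<not> weak_Schur_admissible 3 4 l (4 * l + 4)"
proof
  assume "weak_Schur_admissible 3 4 l (4 * l + 4)"
  then obtain ps where ps: "length ps = 4" "\<And>a b c. (a, b, c) \<in> set ps \<Longrightarrow> sum_free_profile l (a, b, c)"
    "sum_list ps = ((4 * l + 4) div 3, (4 * l + 4 + 2) div 3, (4 * l + 4 + 1) div 3)"
    using weak_Schur_admissible_3_obtain by metis
  define t where "t = l div 9"
  have l: "l = 9 * t + 4" using assms unfolding t_def by presburger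
  have l2: "l \<ge> 2" and l1: "l mod 3 = 1" using l by (simp, presburger)
  have sum: "sum_list ps = (12 * t + 6, 12 * t + 7, 12 * t + 7)" unfolding ps(3) l by (simp; presburger)
  have le: "a + b + c \<le> l + 1" if "(a, b, c) \<in> set ps" for a b c
    using sum_free_profile_large(3)[OF ps(2)[OF that] l2] l1 by linarith
  have size: "a + b + c = Suc l" if abc: "(a, b, c) \<in> set ps" for a b c
  proof -
    obtain xs ys where xy: "ps = xs @ (a, b, c) # ys" using split_list[OF abc] by blast
    obtain A B C where s: "sum_list (xs @ ys) = (A, B, C)" by (metis prod_cases3)
    have "A + B + C \<le> (l + 1) * 3"
      using total_le[OF s, of "l + 1"] le ps(1) by (simp add: xy)
    moreover have "sum_list ps = (a, b, c) + (A, B, C)"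
      by (simp add: xy flip: s) (simp add: ac_simps)
    ultimately show ?thesis using le[OF abc] sum l by simp
  qed
  have mods: "(a = 0 \<and> b mod 3 = 1 \<and> c mod 3 = 1) \<or> (a mod 3 = 1 \<and> b = 0 \<and> c mod 3 = 1) \<or>
      (a mod 3 = 1 \<and> b mod 3 = 1 \<and> c = 0)" if "(a, b, c) \<in> set ps" for a b c
    using sum_free_profile_Suc_mod(2)[OF ps(2)[OF that] l2 size[OF that] l1] .
  define supp :: "nat list \<Rightarrow> nat" where "supp xs = length (filter (\<lambda>x. x > 0) xs)" for xs
  let ?a = "supp (map fst ps)" and ?b = "supp (map (fst \<circ> snd) ps)" and ?c = "supp (map (snd \<circ> snd) ps)"
  have count: "?a + ?b + ?c = 8"
    using support_count[of ps] mods ps(1) unfolding supp_def by fastforce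
  have "?b \<le> 4" "?c \<le> 4"
    unfolding supp_def using length_filter_le ps(1) by (metis length_map)+
  moreover have "?b mod 3 = 1" "?c mod 3 = 1"
  proof -
    have "sum_list (map (fst \<circ> snd) ps) mod 3 = ?b mod 3" "sum_list (map (snd \<circ> snd) ps) mod 3 = ?c mod 3"
      unfolding supp_def using mods by (intro sum_list_mod_support; fastforce)+
    moreover have "(12 * t + 7) mod 3 = 1" by presburger
    ultimately show "?b mod 3 = 1" "?c mod 3 = 1"
      using sum sum_list_profile_components[of ps] by simp_all
  qed
  moreover have "x = 1 \<or> x = 4" if "x \<le> 4" "x mod 3 = 1" for x :: nat
  proof -
    have "x \<in> {0, 1, 2, 3, 4}" using that(1) by auto
    thus ?thesis using that(2) by auto
  qed
  ultimately have "?b = 1 \<or> ?b = 4" "?c = 1 \<or> ?c = 4" by blast+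
  moreover have "12 * t + 6 \<le> (l + 1) * ?a" "12 * t + 7 \<le> (l + 1) * ?b" "12 * t + 7 \<le> (l + 1) * ?c"
  proof -
    have "sum_list (map fst ps) \<le> (l + 1) * ?a" "sum_list (map (fst \<circ> snd) ps) \<le> (l + 1) * ?b"
      "sum_list (map (snd \<circ> snd) ps) \<le> (l + 1) * ?c"
      unfolding supp_def using le by (intro sum_list_le_support; fastforce)+
    thus "12 * t + 6 \<le> (l + 1) * ?a" "12 * t + 7 \<le> (l + 1) * ?b" "12 * t + 7 \<le> (l + 1) * ?c"
      using sum sum_list_profile_components[of ps] by simp_all
  qed
  ultimately show False
    using count l by (elim disjE) simp_all
qed

section \<open>The values of WS modulo 3\<close>

theorem theorem1p4:
  fixes k l :: nat
  assumes "k \<ge> 1" and "l \<ge> 1"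
  shows
    "(k \<ge> 1 \<and> l = 1 \<longrightarrow> WS 3 k l = 3 * k) \<and>
     (k = 1 \<and> l \<ge> 2 \<longrightarrow> WS 3 k l = l) \<and>
     (k = 2 \<and> l \<ge> 2 \<and> ([l = 0] (mod 9) \<or> [l = 1] (mod 9) \<or> [l = 5] (mod 9)) \<longrightarrow>
        WS 3 k l = 2 * l + 2) \<and>
     (k = 2 \<and> l = 3 \<longrightarrow> WS 3 k l = 2 * l + 1) \<and>
     (k = 2 \<and> l \<ge> 5 \<and>
        ([l = 2] (mod 9) \<or> [l = 3] (mod 9) \<or> [l = 4] (mod 9) \<or>
         [l = 6] (mod 9) \<or> [l = 7] (mod 9) \<or> [l = 8] (mod 9)) \<longrightarrow>
        WS 3 k l = 2 * l + 1) \<and>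
     (k = 2 \<and> l \<in> {2, 4} \<longrightarrow> WS 3 k l = 2 * l) \<and>
     (k \<ge> 3 \<and> ([l = 0] (mod 3) \<or> [l = 2] (mod 3)) \<longrightarrow>
        WS 3 k l = 3 * (k - 2) * l + 2) \<and>
     ((k = 3 \<or> k \<ge> 5) \<and> l \<ge> 2 \<and> [l = 1] (mod 3) \<longrightarrow> WS 3 k l = k * (l + 1)) \<and>
     (k = 4 \<and> l \<ge> 2 \<and> ([l = 1] (mod 9) \<or> [l = 7] (mod 9)) \<longrightarrow>
        WS 3 k l = k * (l + 1)) \<and>
     (k = 4 \<and> [l = 4] (mod 9) \<longrightarrow> WS 3 k l = 4 * l + 3)"
proof (intro conjI impI; elim conjE)
  assume "l = 1"
  thus "WS 3 k l = 3 * k" by (simp only: WS_3_l_1)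
next
  assume "k = 1" "l \<ge> 2"
  thus "WS 3 k l = l" by (simp only: WS_3_k_1)
next
  assume k: "k = 2" and l: "l \<ge> 2" "[l = 0] (mod 9) \<or> [l = 1] (mod 9) \<or> [l = 5] (mod 9)"
  have "\<not> weak_Schur_admissible 3 2 l (Suc (2 * l + 2))"
    using two_parts_bound[OF l(1)] by (simp add: eval_nat_numeral)
  with two_full_parts_construction[OF l] show "WS 3 k l = 2 * l + 2" unfolding k by (intro WS_eqI) simp_all
next
  assume k: "k = 2" and l: "l = 3"
  have "weak_Schur_admissible 3 2 l (2 * l + 1)" "\<not> weak_Schur_admissible 3 2 l (Suc (2 * l + 1))"
    using two_parts_one_full_construction[of l] two_parts_mod_9_obstruction[of l] l by simp_all
  thus "WS 3 k l = 2 * l + 1" unfolding k by (intro WS_eqI) simp_all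
next
  assume k: "k = 2" and "l \<ge> 5" "[l = 2] (mod 9) \<or> [l = 3] (mod 9) \<or> [l = 4] (mod 9) \<or>
         [l = 6] (mod 9) \<or> [l = 7] (mod 9) \<or> [l = 8] (mod 9)"
  hence "weak_Schur_admissible 3 2 l (2 * l + 1)" "\<not> weak_Schur_admissible 3 2 l (2 * l + 2)"
    by (intro two_parts_one_full_construction two_parts_mod_9_obstruction; auto simp: cong_def)+
  thus "WS 3 k l = 2 * l + 1" unfolding k by (intro WS_eqI) simp_all
next
  assume k: "k = 2" and l: "l \<in> {2, 4}"
  have "\<not> weak_Schur_admissible 3 2 l (Suc (2 * l))" using two_parts_small_obstruction[OF l] by simp
  with two_parts_small_construction[OF l] show "WS 3 k l = 2 * l" unfolding k by (intro WS_eqI) simp_all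
next
  assume k: "k \<ge> 3" and "[l = 0] (mod 3) \<or> [l = 2] (mod 3)"
  hence l: "l mod 3 \<noteq> 1" by (auto simp: cong_def)
  hence "l \<ge> 2" using assms(2) by (cases "l = 1") auto
  from obstruction_not_1_mod_3[OF k this l]
  have "\<not> weak_Schur_admissible 3 k l (Suc (3 * (k - 2) * l + 2))"
    by (simp add: eval_nat_numeral)
  with construction_not_1_mod_3[OF k l] show "WS 3 k l = 3 * (k - 2) * l + 2" by (intro WS_eqI) simp_all
next
  assume k: "k = 3 \<or> k \<ge> 5" and l: "l \<ge> 2" and "[l = 1] (mod 3)"
  hence l1: "l mod 3 = 1" by (simp add: cong_def)
  show "WS 3 k l = k * (l + 1)"
    by (rule WS_eqI[OF _ construction_1_mod_3[OF l1 l k] obstruction_1_mod_3[OF l l1]]) simp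
next
  assume k: "k = 4" and l: "l \<ge> 2" and "[l = 1] (mod 9) \<or> [l = 7] (mod 9)"
  hence l9: "l mod 9 = 1 \<or> l mod 9 = 7" by (simp add: cong_def)
  hence l1: "l mod 3 = 1" by presburger
  show "WS 3 k l = k * (l + 1)"
    unfolding k by (rule WS_eqI[OF _ four_full_parts_construction[OF l9 l] obstruction_1_mod_3[OF l l1]]) simp
next
  assume k: "k = 4" and "[l = 4] (mod 9)"
  hence l: "l mod 9 = 4" by (simp add: cong_def)
  have "\<not> weak_Schur_admissible 3 4 l (Suc (4 * l + 3))"
    using four_parts_obstruction[OF l] by (simp add: eval_nat_numeral)
  with four_parts_construction_minus_one[OF l] show "WS 3 k l = 4 * l + 3" unfolding k by (intro WS_eqI) simp_all
qed

end
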